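(* Let $G$ be a bounded domain in $\mathbb{C}^n$ ($n\ge 2$). Assume that $K$ is a compact subset of $G$ such that through any point $z\in\mathbb{C}^n\setminus K$ passes a complex line disjoint from $K$. Then $G\setminus K$ is a domain such that $k_{G\setminus K}$ is quasi-isometrically equivalent to the restriction $k_G|_{(G\setminus K)\times(G\setminus K)}$. In particular, if $G$ is Gromov $k$-hyperbolic, then so is $G\setminus K$.
   Context: A complex line is a complex affine line in $\mathbb{C}^n$. Let $\mathbb{D}$ be the open unit disc in $\mathbb{C}$. For a domain $\Omega\subset\mathbb{C}^n$, the Lempert function is $l_\Omega(z,w)=\inf\{\tanh^{-1}|\alpha| : \exists\,\varphi:\mathbb{D}\to \Omega \text{ holomorphic with } \varphi(0)=z,\ \varphi(\alpha)=w\}$, and the Kobayashi distance $k_\Omega$ is the largest pseudodistance on $\Omega$ not exceeding $l_\Omega$. Two distances $d_1,d_2$ on a set $X$ are quasi-isometrically equivalent if there are constants $c_1,c_2>0$ such that $c_1^{-1}d_1(x,y)-c_2\le d_2(x,y)\le c_1d_1(x,y)+c_2$ for all $x,y\in X$. For a metric space $(X,d)$ and $x,y,z\in X$, the Gromov product is $(x,y)_z=d(x,z)+d(z,y)-d(x,y)$. Put $S_d(p,q,x,w)=\min\{(p,x)_w,(x,q)_w\}-(p,q)_w$. The space $(X,d)$ is Gromov hyperbolic if $\sup_{p,q,x,w\in X}S_d(p,q,x,w)<\infty$. A domain $\Omega$ is Gromov $k$-hyperbolic if $(\Omega,k_\Omega)$ is Gromov hyperbolic. *)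

theory Defs
  imports "HOL-Analysis.Analysis"
begin

definition domain :: "'a::topological_space set \<Rightarrow> bool" where
  "domain \<Omega> \<longleftrightarrow> open \<Omega> \<and> connected \<Omega> \<and> \<Omega> \<noteq> {}"

definition complex_line :: "(complex^'n) set \<Rightarrow> bool" where
  "complex_line L \<longleftrightarrow> (\<exists>a v. v \<noteq> 0 \<and> L = {a + t *s v | t. True})"

definition holomorphic_disc :: "(complex^'n) set \<Rightarrow> (complex \<Rightarrow> complex^'n) \<Rightarrow> bool" where
  "holomorphic_disc \<Omega> \<phi> \<longleftrightarrow>
     (\<forall>i. (\<lambda>\<zeta>. \<phi> \<zeta> $ i) holomorphic_on ball 0 1) \<and> \<phi> ` ball 0 1 \<subseteq> \<Omega>"

text \<open>The infimum is taken in the extended reals, so that it is \<open>\<infinity>\<close> if no disc joins the points.\<close>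

definition lempert :: "(complex^'n) set \<Rightarrow> complex^'n \<Rightarrow> complex^'n \<Rightarrow> ereal" where
  "lempert \<Omega> z w =
     Inf {ereal (artanh (cmod \<alpha>)) | \<alpha>.
            \<alpha> \<in> ball 0 1 \<and> (\<exists>\<phi>. holomorphic_disc \<Omega> \<phi> \<and> \<phi> 0 = z \<and> \<phi> \<alpha> = w)}"

definition pseudodistance_on :: "'a set \<Rightarrow> ('a \<Rightarrow> 'a \<Rightarrow> real) \<Rightarrow> bool" where
  "pseudodistance_on X d \<longleftrightarrow>
     (\<forall>x\<in>X. d x x = 0) \<and>
     (\<forall>x\<in>X. \<forall>y\<in>X. 0 \<le> d x y \<and> d x y = d y x) \<and>
     (\<forall>x\<in>X. \<forall>y\<in>X. \<forall>z\<in>X. d x z \<le> d x y + d y z)"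

definition sub_lempert :: "(complex^'n) set \<Rightarrow> (complex^'n \<Rightarrow> complex^'n \<Rightarrow> real) set" where
  "sub_lempert \<Omega> =
     {d. pseudodistance_on \<Omega> d \<and> (\<forall>z\<in>\<Omega>. \<forall>w\<in>\<Omega>. ereal (d z w) \<le> lempert \<Omega> z w)}"

text \<open>
  The largest pseudodistance not exceeding the Lempert function is the pointwise supremum of all of
  them; on a domain the supremum is over a bounded set, see \<open>kobayashi_greatest\<close> below.
  The value 0 off \<open>\<Omega>\<close> is a convention that fits the locale \<open>Metric_space\<close>, which demands
  nonnegativity and symmetry everywhere.
\<close>

definition kobayashi :: "(complex^'n) set \<Rightarrow> complex^'n \<Rightarrow> complex^'n \<Rightarrow> real" where
  "kobayashi \<Omega> z w = (if z \<in> \<Omega> \<and> w \<in> \<Omega> then (SUP d\<in>sub_lempert \<Omega>. d z w) else 0)"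

definition quasi_isometrically_equivalent ::
    "'a set \<Rightarrow> ('a \<Rightarrow> 'a \<Rightarrow> real) \<Rightarrow> ('a \<Rightarrow> 'a \<Rightarrow> real) \<Rightarrow> bool" where
  "quasi_isometrically_equivalent X d1 d2 \<longleftrightarrow>
     Metric_space X d1 \<and> Metric_space X d2 \<and>
     (\<exists>c1>0. \<exists>c2>0. \<forall>x\<in>X. \<forall>y\<in>X.
        inverse c1 * d1 x y - c2 \<le> d2 x y \<and> d2 x y \<le> c1 * d1 x y + c2)"

text \<open>The Gromov product is taken without the usual factor 1/2.\<close>

definition gromov_product :: "('a \<Rightarrow> 'a \<Rightarrow> real) \<Rightarrow> 'a \<Rightarrow> 'a \<Rightarrow> 'a \<Rightarrow> real" where
  "gromov_product d x y z = d x z + d z y - d x y"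

definition gromov_defect :: "('a \<Rightarrow> 'a \<Rightarrow> real) \<Rightarrow> 'a \<Rightarrow> 'a \<Rightarrow> 'a \<Rightarrow> 'a \<Rightarrow> real" where
  "gromov_defect d p q x w =
     min (gromov_product d p x w) (gromov_product d x q w) - gromov_product d p q w"

definition gromov_hyperbolic :: "'a set \<Rightarrow> ('a \<Rightarrow> 'a \<Rightarrow> real) \<Rightarrow> bool" where
  "gromov_hyperbolic X d \<longleftrightarrow>
     Metric_space X d \<and>
     bdd_above {gromov_defect d p q x w | p q x w. p \<in> X \<and> q \<in> X \<and> x \<in> X \<and> w \<in> X}"

definition gromov_k_hyperbolic :: "(complex^'n) set \<Rightarrow> bool" where
  "gromov_k_hyperbolic \<Omega> \<longleftrightarrow> gromov_hyperbolic \<Omega> (kobayashi \<Omega>)"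


lemma sub_lempert_zero: "(\<lambda>_ _. 0) \<in> sub_lempert \<Omega>"
proof -
  have "0 \<le> artanh (cmod \<alpha>)" if "cmod \<alpha> < 1" for \<alpha>
    using that by (simp add: artanh_def)
  then show ?thesis
    by (auto simp: sub_lempert_def pseudodistance_on_def lempert_def zero_ereal_def[symmetric]
        intro!: Inf_greatest)
qed

lemma sub_lempert_bdd_above:
  fixes \<Omega> :: "(complex^'n) set"
  assumes "domain \<Omega>" and "z \<in> \<Omega>" and "w \<in> \<Omega>"
  shows "bdd_above ((\<lambda>d. d z w) ` sub_lempert \<Omega>)"
proof -
  define R where "R x y \<longleftrightarrow> (\<exists>B. \<forall>d\<in>sub_lempert \<Omega>. d x y \<le> B)" for x y
  have "R z w"
  proof (rule connected_equivalence_relation[of \<Omega>])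
    show "connected \<Omega>"
      using assms by (simp add: domain_def)
    show "R y x" if "R x y" "x \<in> \<Omega>" "y \<in> \<Omega>" for x y
    proof -
      have "d y x = d x y" if "d \<in> sub_lempert \<Omega>" for d
        using that \<open>x \<in> \<Omega>\<close> \<open>y \<in> \<Omega>\<close> unfolding sub_lempert_def pseudodistance_on_def by blast
      then show ?thesis
        using \<open>R x y\<close> unfolding R_def by metis
    qed
    show "R x u" if "R x y" "R y u" "x \<in> \<Omega>" "y \<in> \<Omega>" "u \<in> \<Omega>" for x y u
    proof -
      obtain B C where B: "\<forall>d\<in>sub_lempert \<Omega>. d x y \<le> B" and C: "\<forall>d\<in>sub_lempert \<Omega>. d y u \<le> C"
        using \<open>R x y\<close> \<open>R y u\<close> unfolding R_def by blast
      have "d x u \<le> B + C" if d: "d \<in> sub_lempert \<Omega>" for d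
      proof -
        have "d x u \<le> d x y + d y u"
          using d \<open>x \<in> \<Omega>\<close> \<open>y \<in> \<Omega>\<close> \<open>u \<in> \<Omega>\<close> unfolding sub_lempert_def pseudodistance_on_def by blast
        then show ?thesis
          using bspec[OF B d] bspec[OF C d] by linarith
      qed
      then show ?thesis
        unfolding R_def by blast
    qed
    show "\<exists>T. openin (top_of_set \<Omega>) T \<and> x \<in> T \<and> (\<forall>y\<in>T. R x y)" if x: "x \<in> \<Omega>" for x
    proof -
      obtain r where r: "r > 0" "ball x r \<subseteq> \<Omega>"
        using assms(1) x by (auto simp: domain_def open_contains_ball)
      have "R x y" if y: "y \<in> ball x (r/2)" for y
      proof -
        define \<phi> where "\<phi> \<zeta> = x + (2 * \<zeta>) *s (y - x)" for \<zeta>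
        have "\<phi> \<zeta> \<in> ball x r" if "\<zeta> \<in> ball 0 1" for \<zeta>
        proof -
          have "norm ((2 * \<zeta>) *s (y - x)) = 2 * cmod \<zeta> * norm (y - x)"
            unfolding norm_vec_def vector_smult_component norm_mult
            by (simp add: L2_set_right_distrib)
          also have "\<dots> \<le> 2 * norm (y - x)"
            using that mult_right_mono[of "cmod \<zeta>" 1 "norm (y - x)"] by simp
          also have "\<dots> < r"
            using y by (simp add: dist_norm norm_minus_commute)
          finally show ?thesis
            unfolding \<phi>_def mem_ball by (metis add_diff_cancel_left' dist_commute dist_norm)
        qed
        then have "\<phi> ` ball 0 1 \<subseteq> \<Omega>"
          using r by blast
        moreover have "(\<lambda>\<zeta>. \<phi> \<zeta> $ i) holomorphic_on ball 0 1" for i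
          unfolding \<phi>_def vector_add_component vector_smult_component
          by (intro holomorphic_intros)
        ultimately have disc: "holomorphic_disc \<Omega> \<phi>"
          by (simp add: holomorphic_disc_def)
        have "y \<in> \<Omega>"
          using y r by (auto simp: subset_iff)
        have "lempert \<Omega> x y \<le> ereal (artanh (cmod (1/2)))"
          unfolding lempert_def
        proof (rule Inf_lower, safe)
          show "\<exists>\<alpha>. ereal (artanh (cmod (1/2))) = ereal (artanh (cmod \<alpha>)) \<and> \<alpha> \<in> ball 0 1 \<and>
                  (\<exists>\<phi>. holomorphic_disc \<Omega> \<phi> \<and> \<phi> 0 = x \<and> \<phi> \<alpha> = y)"
            using disc by (intro exI[of _ "1/2"] conjI exI[of _ \<phi>]) (auto simp: \<phi>_def vec_eq_iff)
        qed
        then have "d x y \<le> artanh (cmod (1/2))" if "d \<in> sub_lempert \<Omega>" for d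
          using that x \<open>y \<in> \<Omega>\<close> order_trans[of "ereal (d x y)"] unfolding sub_lempert_def
          by (metis (no_types, lifting) ereal_less_eq(3) mem_Collect_eq)
        then show ?thesis
          unfolding R_def by blast
      qed
      moreover have "openin (top_of_set \<Omega>) (ball x (r/2))"
      proof (rule open_subset)
        have "ball x (r/2) \<subseteq> ball x r"
          using r by (simp add: subset_ball)
        with r show "ball x (r/2) \<subseteq> \<Omega>"
          by blast
      qed simp
      ultimately show ?thesis
        using r by (intro exI[of _ "ball x (r/2)"]) auto
    qed
  qed (use assms in auto)
  then show ?thesis
    by (auto simp: R_def bdd_above_def)
qed

theorem kobayashi_greatest:
  assumes "domain \<Omega>"
  shows "kobayashi \<Omega> \<in> sub_lempert \<Omega>"
    and "\<And>d z w. \<lbrakk>d \<in> sub_lempert \<Omega>; z \<in> \<Omega>; w \<in> \<Omega>\<rbrakk> \<Longrightarrow> d z w \<le> kobayashi \<Omega> z w"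
proof -
  let ?k = "kobayashi \<Omega>"
  have ne: "sub_lempert \<Omega> \<noteq> {}"
    using sub_lempert_zero by blast
  show upper: "d z w \<le> ?k z w" if "d \<in> sub_lempert \<Omega>" "z \<in> \<Omega>" "w \<in> \<Omega>" for d z w
    using that sub_lempert_bdd_above[OF assms] by (auto simp: kobayashi_def intro!: cSUP_upper)
  have least: "?k z w \<le> B" if "z \<in> \<Omega>" "w \<in> \<Omega>" "\<And>d. d \<in> sub_lempert \<Omega> \<Longrightarrow> d z w \<le> B" for z w B
    using that ne by (auto simp: kobayashi_def intro!: cSUP_least)
  have nonneg: "0 \<le> ?k z w" if "z \<in> \<Omega>" "w \<in> \<Omega>" for z w
    using upper[OF sub_lempert_zero that] .
  have sym: "?k z w \<le> ?k w z" if zw: "z \<in> \<Omega>" "w \<in> \<Omega>" for z w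
  proof (rule least[OF zw])
    fix d assume d: "d \<in> sub_lempert \<Omega>"
    then have "d z w = d w z"
      using zw by (auto simp: sub_lempert_def pseudodistance_on_def)
    then show "d z w \<le> ?k w z"
      using upper[OF d zw(2) zw(1)] by simp
  qed
  have tri: "?k x z \<le> ?k x y + ?k y z" if xyz: "x \<in> \<Omega>" "y \<in> \<Omega>" "z \<in> \<Omega>" for x y z
  proof (rule least[OF xyz(1) xyz(3)])
    fix d assume d: "d \<in> sub_lempert \<Omega>"
    then have "d x z \<le> d x y + d y z"
      using xyz by (auto simp: sub_lempert_def pseudodistance_on_def)
    then show "d x z \<le> ?k x y + ?k y z"
      using upper[OF d xyz(1) xyz(2)] upper[OF d xyz(2) xyz(3)] by linarith
  qed
  have diag: "?k x x = 0" if x: "x \<in> \<Omega>" for x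
  proof (rule antisym)
    show "?k x x \<le> 0"
      by (rule least[OF x x]) (use x in \<open>auto simp: sub_lempert_def pseudodistance_on_def\<close>)
  qed (rule nonneg[OF x x])
  have le: "ereal (?k z w) \<le> lempert \<Omega> z w" if zw: "z \<in> \<Omega>" "w \<in> \<Omega>" for z w
  proof (cases "lempert \<Omega> z w")
    case (real l)
    have "?k z w \<le> l"
    proof (rule least[OF zw])
      fix d assume "d \<in> sub_lempert \<Omega>"
      then have "ereal (d z w) \<le> ereal l"
        unfolding real[symmetric] using zw by (auto simp: sub_lempert_def)
      then show "d z w \<le> l" by simp
    qed
    with real show ?thesis by simp
  next
    case MInf
    have "ereal 0 \<le> lempert \<Omega> z w"
      using sub_lempert_zero[of \<Omega>] zw unfolding sub_lempert_def by blast
    with MInf show ?thesis by simp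
  qed simp
  show "?k \<in> sub_lempert \<Omega>"
    unfolding sub_lempert_def pseudodistance_on_def
    by (simp add: nonneg tri diag le antisym[OF sym sym])
qed

end

theory Submission
  imports Defs "HOL-Complex_Analysis.Riemann_Mapping"
begin

text \<open>
  The two distances differ by a bounded amount:
  \<open>kobayashi G \<le> kobayashi (G - K) \<le> kobayashi G + C\<close> on \<open>G - K\<close>
  (\<open>kobayashi_antimono\<close>, \<open>kobayashi_Diff_le_add_const\<close>). This is more than a
  quasi-isometry, and it matters: Gromov hyperbolicity is a four-point condition that survives
  bounded perturbations of the metric for trivial reasons, while its invariance under
  quasi-isometries needs geodesics.

  For the upper bound, join two points of \<open>G - K\<close> by a chain of short discs in \<open>G\<close> that is
  almost as short as the distance of its ends (\<open>kobayashi_near_chain\<close>), and let \<open>\<rho>\<close> be the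
  Kobayashi distance in \<open>G\<close> to a fixed point of \<open>K\<close>. A disc in \<open>G\<close> centred at \<open>x\<close> cannot meet
  \<open>K\<close> before its parameter has hyperbolic length about \<open>\<rho> x\<close>. Restricting it to the disc of
  radius \<open>tanh (\<rho> x)\<close> gives a disc in \<open>G - K\<close>, and the rescaling lengthens a step of length
  \<open>t\<close> by only \<open>O(t * exp (- 2 * \<rho> x))\<close> (\<open>kobayashi_Diff_step_le\<close>). Let \<open>m\<close> be the vertex of the
  chain that is closest to \<open>K\<close>. Since the chain is almost geodesic, another vertex \<open>x\<close> at arc length
  \<open>u\<close> from \<open>m\<close> satisfies \<open>u - 1 \<le> \<rho> x + \<rho> m \<le> 2 * \<rho> x\<close>, so the total error is controlled by the
  integral of \<open>exp (- \<bar>u\<bar>)\<close>, whatever the length of the chain (\<open>near_geodesic_exp_decay\<close>).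

  Rescaling fails only close to \<open>K\<close>. There the hypothesis on lines enters: a point near \<open>K\<close> can walk
  along its line, inside round discs that avoid \<open>K\<close>, to a compact shell around \<open>K\<close>. Hence the part of
  \<open>G - K\<close> near \<open>K\<close> has finite diameter (\<open>kobayashi_bounded_near_removed_compact\<close>), and the piece
  of the chain between its first and its last vertex near \<open>K\<close> costs only a constant.

  The set \<open>G - K\<close> is connected because the complement of \<open>K\<close> is, the lines leading every point to
  infinity, and because in Euclidean space two disjoint closed sets, here \<open>K\<close> and the complement of
  \<open>G\<close>, cannot jointly separate points that neither of them separates.
\<close>

section \<open>The hyperbolic length scale on the unit disc\<close>

lemma tanh_artanh_real:
  fixes a :: real
  assumes "\<bar>a\<bar> < 1"
  shows "tanh (artanh a) = a"
proof -
  have *: "exp (- 2 * artanh a) = (1 - a) / (1 + a)"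
    using assms by (simp add: artanh_def exp_minus)
  show ?thesis
    unfolding tanh_real_altdef * using assms by (simp add: field_simps)
qed

text \<open>
  The derivative of \<open>artanh\<close> at \<open>z\<close> is \<open>1 / (1 - z\<^sup>2)\<close>, which increases from 1 on the positive axis.
\<close>

lemma artanh_diff_bounds:
  fixes a b :: real
  assumes "0 \<le> a" "a \<le> b" "b < 1"
  shows "b - a \<le> artanh b - artanh a"
    and "artanh b - artanh a \<le> (b - a) / (1 - b\<^sup>2)"
proof -
  have "b - a \<le> artanh b - artanh a \<and> artanh b - artanh a \<le> (b - a) / (1 - b\<^sup>2)"
  proof (cases "a = b")
    case False
    then obtain z where z: "a < z" "z < b" "artanh b - artanh a = (b - a) * (1 / (1 - z\<^sup>2))"
      using MVT2[of a b artanh "\<lambda>x. 1 / (1 - x\<^sup>2)"] assms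
      by (force intro!: artanh_real_has_field_derivative)
    have sq: "0 \<le> z\<^sup>2" "z\<^sup>2 \<le> b\<^sup>2" "b\<^sup>2 < 1"
      using z assms by (auto intro!: power_mono simp: power_less_one_iff abs_square_less_1)
    have "1 \<le> 1 / (1 - z\<^sup>2)" "1 / (1 - z\<^sup>2) \<le> 1 / (1 - b\<^sup>2)"
      using sq by (auto simp: field_simps)
    then show ?thesis
      unfolding z(3) using assms mult_left_mono[of 1 "1 / (1 - z\<^sup>2)" "b - a"]
        mult_left_mono[of "1 / (1 - z\<^sup>2)" "1 / (1 - b\<^sup>2)" "b - a"] by auto
  qed simp
  then show "b - a \<le> artanh b - artanh a" "artanh b - artanh a \<le> (b - a) / (1 - b\<^sup>2)"
    by auto
qed

lemma tanh_le_self: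
  fixes t :: real
  assumes "0 \<le> t"
  shows "tanh t \<le> t"
  using artanh_diff_bounds(1)[of 0 "tanh t"] assms tanh_real_lt_1[of t] by (simp add: artanh_tanh_real)

lemma one_minus_tanh_le:
  fixes t :: real
  shows "1 - tanh t \<le> 2 * exp (- 2 * t)"
proof -
  define q where "q = exp (- 2 * t)"
  have q: "0 < q"
    by (simp add: q_def)
  have "1 - tanh t = 2 * q / (1 + q)"
    unfolding tanh_real_altdef q_def[symmetric] using q by (simp add: field_simps)
  also have "\<dots> \<le> 2 * q"
    using q by (simp add: divide_le_eq)
  finally show ?thesis
    by (simp add: q_def)
qed

section \<open>Discs joining two points\<close>

lemma holomorphic_disc_compose:
  assumes "holomorphic_disc \<Omega> \<phi>" "m holomorphic_on ball 0 1" "m ` ball 0 1 \<subseteq> ball 0 1"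
  shows "holomorphic_disc \<Omega> (\<phi> \<circ> m)"
  unfolding holomorphic_disc_def
proof (intro conjI allI)
  show "(\<lambda>\<zeta>. (\<phi> \<circ> m) \<zeta> $ i) holomorphic_on ball 0 1" for i
    using holomorphic_on_compose_gen[of m "ball 0 1" "\<lambda>\<zeta>. \<phi> \<zeta> $ i" "ball 0 1"] assms
    by (simp add: holomorphic_disc_def comp_def)
  show "(\<phi> \<circ> m) ` ball 0 1 \<subseteq> \<Omega>"
    using assms unfolding holomorphic_disc_def image_comp[symmetric] by blast
qed

text \<open>
  A disc that realises \<open>t\<close> as a competitor in the Lempert function, normalised by a rotation so that
  the parameter of the second point is the real number at hyperbolic distance \<open>t\<close> from the centre.
  With this normalisation the points \<open>tanh s\<close> of the real diameter form a one-parameter group under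
  the automorphisms of the disc, and discs can be subdivided and reversed.
\<close>

definition disc_step :: "(complex^'n) set \<Rightarrow> complex^'n \<Rightarrow> complex^'n \<Rightarrow> real \<Rightarrow> bool" where
  "disc_step \<Omega> u v t \<longleftrightarrow>
     0 \<le> t \<and> (\<exists>\<phi>. holomorphic_disc \<Omega> \<phi> \<and> \<phi> 0 = u \<and> \<phi> (of_real (tanh t)) = v)"

lemma of_real_tanh_in_ball: "complex_of_real (tanh t) \<in> ball 0 1"
  using tanh_real_bounds[of t] by auto

lemma disc_step_mem:
  assumes "disc_step \<Omega> u v t"
  shows "0 \<le> t" "u \<in> \<Omega>" "v \<in> \<Omega>"
  using assms of_real_tanh_in_ball[of t] by (auto simp: disc_step_def holomorphic_disc_def)

text \<open>
  A Moebius transformation moves the point \<open>tanh s\<close> of a disc to its centre. On the real diameter it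
  acts as the addition formula for \<open>tanh\<close>, that is, as a translation of the hyperbolic length.
\<close>

lemma disc_step_between:
  assumes \<phi>: "holomorphic_disc \<Omega> \<phi>"
  shows "disc_step \<Omega> (\<phi> (of_real (tanh s))) (\<phi> (of_real (tanh t))) \<bar>t - s\<bar>"
proof -
  define b where "b = complex_of_real (tanh s)"
  \<comment> \<open>The sign turns the diameter round when \<open>t\<close> comes before \<open>s\<close>.\<close>
  define \<epsilon> :: real where "\<epsilon> = (if s \<le> t then 1 else -1)"
  define m where "m \<zeta> = Moebius_function 0 (- b) (of_real \<epsilon> * \<zeta>)" for \<zeta>
  have b: "norm (- b) < 1"
    using of_real_tanh_in_ball[of s] by (simp add: b_def)
  have \<epsilon>: "\<bar>\<epsilon>\<bar> = 1"
    by (simp add: \<epsilon>_def)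
  have "(Moebius_function 0 (- b) \<circ> (\<lambda>\<zeta>. of_real \<epsilon> * \<zeta>)) holomorphic_on ball 0 1"
    by (rule holomorphic_on_compose_gen[OF _ Moebius_function_holomorphic[OF b]])
       (auto intro!: holomorphic_intros simp: norm_mult \<epsilon>)
  then have holo: "m holomorphic_on ball 0 1"
    by (simp add: m_def[abs_def] comp_def)
  have range: "m ` ball 0 1 \<subseteq> ball 0 1"
    using Moebius_function_norm_lt_1[OF b] by (auto simp: m_def norm_mult \<epsilon>)
  have *: "\<epsilon> * tanh \<bar>t - s\<bar> = tanh (t - s)"
    by (auto simp: \<epsilon>_def abs_if simp flip: tanh_minus)
  have "m (of_real (tanh \<bar>t - s\<bar>)) = Moebius_function 0 (- b) (of_real (\<epsilon> * tanh \<bar>t - s\<bar>))"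
    by (simp add: m_def)
  also have "\<dots> = of_real ((tanh (t - s) + tanh s) / (1 + tanh (t - s) * tanh s))"
    unfolding * by (simp add: Moebius_function_simple b_def mult.commute)
  also have "\<dots> = of_real (tanh t)"
    using tanh_add[of "t - s" s] by simp
  finally have "m (of_real (tanh \<bar>t - s\<bar>)) = of_real (tanh t)" .
  moreover have "m 0 = of_real (tanh s)"
    by (simp add: m_def Moebius_function_simple b_def)
  ultimately show ?thesis
    unfolding disc_step_def
    by (intro conjI exI[of _ "\<phi> \<circ> m"] holomorphic_disc_compose[OF \<phi> holo range]) auto
qed

lemma disc_step_sym:
  assumes "disc_step \<Omega> u v t"
  shows "disc_step \<Omega> v u t"
proof -
  obtain \<phi> where \<phi>: "0 \<le> t" "holomorphic_disc \<Omega> \<phi>" "\<phi> 0 = u" "\<phi> (of_real (tanh t)) = v"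
    using assms by (auto simp: disc_step_def)
  show ?thesis
    using disc_step_between[OF \<phi>(2), of t 0] \<phi> by simp
qed

lemma disc_stepI:
  assumes \<phi>: "holomorphic_disc \<Omega> \<phi>" and \<alpha>: "cmod \<alpha> < 1"
  shows "disc_step \<Omega> (\<phi> 0) (\<phi> \<alpha>) (artanh (cmod \<alpha>))"
proof -
  define u where "u = (if \<alpha> = 0 then 1 else sgn \<alpha>)"
  have u: "cmod u = 1" "\<alpha> = of_real (cmod \<alpha>) * u"
    by (simp_all add: u_def norm_sgn) (simp add: sgn_eq)
  have "0 \<le> artanh (cmod \<alpha>)"
    using \<alpha> by (simp add: artanh_def)
  moreover have "holomorphic_disc \<Omega> (\<phi> \<circ> (\<lambda>\<zeta>. \<zeta> * u))"
    by (rule holomorphic_disc_compose[OF \<phi>]) (auto intro!: holomorphic_intros simp: norm_mult u(1))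
  ultimately show ?thesis
    unfolding disc_step_def using tanh_artanh_real[of "cmod \<alpha>"] \<alpha> u(2)
    by (intro conjI exI[of _ "\<phi> \<circ> (\<lambda>\<zeta>. \<zeta> * u)"]) auto
qed

lemma lempert_eq_Inf_disc_step: "lempert \<Omega> z w = Inf {ereal t |t. disc_step \<Omega> z w t}"
  unfolding lempert_def
proof (rule arg_cong[where f = Inf], safe)
  fix \<alpha> :: complex and \<phi>
  assume "\<alpha> \<in> ball 0 1" "holomorphic_disc \<Omega> \<phi>"
  then show "\<exists>t. ereal (artanh (cmod \<alpha>)) = ereal t \<and> disc_step \<Omega> (\<phi> 0) (\<phi> \<alpha>) t"
    using disc_stepI[of \<Omega> \<phi> \<alpha>] by auto
next
  fix t assume "disc_step \<Omega> z w t"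
  then obtain \<phi> where \<phi>: "0 \<le> t" "holomorphic_disc \<Omega> \<phi>" "\<phi> 0 = z" "\<phi> (of_real (tanh t)) = w"
    by (auto simp: disc_step_def)
  then have "artanh (cmod (of_real (tanh t))) = t"
    by (simp add: artanh_tanh_real)
  then show "\<exists>\<alpha>::complex. ereal t = ereal (artanh (cmod \<alpha>)) \<and> \<alpha> \<in> ball 0 1 \<and>
      (\<exists>\<phi>. holomorphic_disc \<Omega> \<phi> \<and> \<phi> 0 = z \<and> \<phi> \<alpha> = w)"
    using \<phi> of_real_tanh_in_ball[of t] by (intro exI[of _ "of_real (tanh t)"]) auto
qed

text \<open>
  Membership in \<open>\<Omega>\<close> and the extended reals are absorbed by \<open>disc_step\<close>: an infinite Lempert function
  is an empty set of steps.
\<close>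

lemma sub_lempert_iff:
  "d \<in> sub_lempert \<Omega> \<longleftrightarrow>
     pseudodistance_on \<Omega> d \<and> (\<forall>u v t. disc_step \<Omega> u v t \<longrightarrow> d u v \<le> t)"
proof -
  have "ereal (d u v) \<le> lempert \<Omega> u v \<longleftrightarrow> (\<forall>t. disc_step \<Omega> u v t \<longrightarrow> d u v \<le> t)" for u v
    unfolding lempert_eq_Inf_disc_step le_Inf_iff by auto
  then show ?thesis
    unfolding sub_lempert_def using disc_step_mem(2,3) by blast
qed

section \<open>Elementary properties of the Kobayashi distance\<close>

lemma disc_step_mono:
  assumes "disc_step \<Omega> u v t" "\<Omega> \<subseteq> \<Omega>'"
  shows "disc_step \<Omega>' u v t"
  using assms unfolding disc_step_def holomorphic_disc_def by blast

context
  fixes \<Omega> :: "(complex^'n) set"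
  assumes \<Omega>: "domain \<Omega>"
begin

lemma kobayashi_le_step: "disc_step \<Omega> u v t \<Longrightarrow> kobayashi \<Omega> u v \<le> t"
  using kobayashi_greatest(1)[OF \<Omega>] by (simp add: sub_lempert_iff)

lemma kobayashi_refl: "kobayashi \<Omega> x x = 0"
  using kobayashi_greatest(1)[OF \<Omega>]
  by (cases "x \<in> \<Omega>") (auto simp: kobayashi_def sub_lempert_def pseudodistance_on_def)

lemma kobayashi_nonneg: "0 \<le> kobayashi \<Omega> x y"
  using kobayashi_greatest(1)[OF \<Omega>]
  by (cases "x \<in> \<Omega> \<and> y \<in> \<Omega>") (auto simp: kobayashi_def sub_lempert_def pseudodistance_on_def)

lemma kobayashi_commute: "kobayashi \<Omega> x y = kobayashi \<Omega> y x"
proof (cases "x \<in> \<Omega> \<and> y \<in> \<Omega>")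
  case True
  then show ?thesis
    using kobayashi_greatest(1)[OF \<Omega>] by (simp add: sub_lempert_def pseudodistance_on_def)
qed (auto simp: kobayashi_def)

lemma kobayashi_triangle:
  assumes "x \<in> \<Omega>" "y \<in> \<Omega>" "z \<in> \<Omega>"
  shows "kobayashi \<Omega> x z \<le> kobayashi \<Omega> x y + kobayashi \<Omega> y z"
  using kobayashi_greatest(1)[OF \<Omega>] assms by (simp add: sub_lempert_def pseudodistance_on_def)

end

text \<open>
  The restriction of the larger domain's distance competes in the supremum of the smaller one.
\<close>

lemma kobayashi_antimono:
  assumes "domain \<Omega>" "domain \<Omega>'" "\<Omega> \<subseteq> \<Omega>'" "x \<in> \<Omega>" "y \<in> \<Omega>"
  shows "kobayashi \<Omega>' x y \<le> kobayashi \<Omega> x y"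
proof (rule kobayashi_greatest(2)[OF assms(1) _ assms(4,5)])
  have "pseudodistance_on \<Omega> (kobayashi \<Omega>')"
    unfolding pseudodistance_on_def
    by (intro conjI ballI kobayashi_refl[OF assms(2)] kobayashi_nonneg[OF assms(2)]
        kobayashi_commute[OF assms(2)] kobayashi_triangle[OF assms(2)]) (use assms(3) in auto)
  then show "kobayashi \<Omega>' \<in> sub_lempert \<Omega>"
    unfolding sub_lempert_iff
    by (intro conjI allI impI kobayashi_le_step[OF assms(2)] disc_step_mono[OF _ assms(3)])
qed

section \<open>Discs in lines and balls\<close>

lemma norm_vector_smult:
  fixes x :: "complex^'n"
  shows "norm (c *s x) = cmod c * norm x"
  unfolding norm_vec_def vector_smult_component norm_mult
  by (simp add: L2_set_right_distrib)

lemma disc_step_along_line: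
  fixes x v :: "complex^'n"
  assumes "\<And>\<zeta>. cmod \<zeta> < 1 \<Longrightarrow> x + (r * \<zeta>) *s v \<in> \<Omega>" "cmod \<alpha> < 1"
  shows "disc_step \<Omega> x (x + (r * \<alpha>) *s v) (artanh (cmod \<alpha>))"
proof -
  have "holomorphic_disc \<Omega> (\<lambda>\<zeta>. x + (r * \<zeta>) *s v)"
    unfolding holomorphic_disc_def using assms(1)
    by (auto intro!: holomorphic_intros)
  from disc_stepI[OF this assms(2)] show ?thesis
    by simp
qed

lemma disc_step_ball:
  fixes x y :: "complex^'n"
  assumes "ball x r \<subseteq> \<Omega>" "y \<in> ball x (r / 2)"
  shows "disc_step \<Omega> x y (artanh (1 / 2))"
proof -
  have "x + (2 * \<zeta>) *s (y - x) \<in> \<Omega>" if "cmod \<zeta> < 1" for \<zeta>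
  proof -
    have "norm ((2 * \<zeta>) *s (y - x)) = cmod \<zeta> * (2 * norm (y - x))"
      by (simp add: norm_vector_smult norm_mult del: vector_ssub_ldistrib)
    also have "\<dots> \<le> 2 * norm (y - x)"
      using that mult_right_mono[of "cmod \<zeta>" 1 "2 * norm (y - x)"] by simp
    also have "\<dots> < r"
      using assms(2) by (simp add: dist_norm norm_minus_commute)
    finally have "x + (2 * \<zeta>) *s (y - x) \<in> ball x r"
      by (metis add_diff_cancel_left' dist_commute dist_norm mem_ball)
    then show ?thesis
      using assms(1) by blast
  qed
  from disc_step_along_line[OF this, of "1 / 2"] show ?thesis
    by (simp add: norm_divide)
qed

section \<open>The Kobayashi distance as an infimum over chains of short discs\<close>

inductive disc_chain ::
    "(complex^'n) set \<Rightarrow> real \<Rightarrow> complex^'n \<Rightarrow> complex^'n \<Rightarrow> real \<Rightarrow> bool"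
  for \<Omega> :: "(complex^'n) set" and \<eta> :: real where
  disc_chain_refl: "x \<in> \<Omega> \<Longrightarrow> disc_chain \<Omega> \<eta> x x 0"
| disc_chain_step: "disc_step \<Omega> x y t \<Longrightarrow> t \<le> \<eta> \<Longrightarrow> disc_chain \<Omega> \<eta> y z l \<Longrightarrow>
     disc_chain \<Omega> \<eta> x z (t + l)"

lemma disc_chain_mem:
  assumes "disc_chain \<Omega> \<eta> x y l"
  shows "x \<in> \<Omega> \<and> y \<in> \<Omega> \<and> 0 \<le> l"
  using assms by induction (auto simp: disc_step_mem)

lemma disc_chain_trans:
  assumes "disc_chain \<Omega> \<eta> x y l" "disc_chain \<Omega> \<eta> y z l'"
  shows "disc_chain \<Omega> \<eta> x z (l + l')"
  using assms
proof (induction arbitrary: z l')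
  case (disc_chain_step x y t z l)
  then show ?case
    using disc_chain.disc_chain_step[of \<Omega> x y t \<eta>] by (simp add: add.assoc)
qed simp

lemma disc_chain_single:
  assumes "disc_step \<Omega> x y t" "t \<le> \<eta>"
  shows "disc_chain \<Omega> \<eta> x y t"
  using disc_chain_step[OF assms disc_chain_refl] disc_step_mem[OF assms(1)] by simp

lemma disc_chain_sym:
  assumes "disc_chain \<Omega> \<eta> x y l"
  shows "disc_chain \<Omega> \<eta> y x l"
  using assms
proof induction
  case (disc_chain_step x y t z l)
  then show ?case
    using disc_chain_trans[OF disc_chain_step.IH
        disc_chain_single[OF disc_step_sym[OF disc_chain_step.hyps(1)]]]
    by (simp add: add.commute)
qed (rule disc_chain_refl)

lemma disc_step_subdivide:
  assumes "disc_step \<Omega> u v t" "0 < \<eta>"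
  shows "disc_chain \<Omega> \<eta> u v t"
proof -
  obtain \<phi> where \<phi>: "0 \<le> t" "holomorphic_disc \<Omega> \<phi>" "\<phi> 0 = u" "\<phi> (of_real (tanh t)) = v"
    using assms(1) by (auto simp: disc_step_def)
  obtain n :: nat where "t / \<eta> < n"
    using reals_Archimedean2 by blast
  then have *: "t < n * \<eta>"
    using assms(2) by (simp add: pos_divide_less_eq)
  then have n: "0 < n"
    using \<phi>(1) by (auto intro!: gr0I)
  with * have small: "t / n \<le> \<eta>"
    by (simp add: pos_divide_le_eq mult.commute)
  define h where "h = t / n"
  have h: "0 \<le> h" "h \<le> \<eta>" "n * h = t"
    using \<phi>(1) n small by (auto simp: h_def)
  have "disc_chain \<Omega> \<eta> u (\<phi> (of_real (tanh (j * h)))) (j * h)" for j :: nat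
  proof (induction j)
    case 0
    then show ?case
      using disc_chain_refl[of u \<Omega> \<eta>] disc_step_mem[OF assms(1)] \<phi> by simp
  next
    case (Suc j)
    have "Suc j * h - j * h = h"
      by (simp add: algebra_simps)
    then have "disc_step \<Omega> (\<phi> (of_real (tanh (j * h)))) (\<phi> (of_real (tanh (Suc j * h)))) h"
      using disc_step_between[OF \<phi>(2), of "j * h" "Suc j * h"] h(1) by simp
    moreover have "j * h + h = Suc j * h"
      by (simp add: algebra_simps)
    ultimately show ?case
      using disc_chain_trans[OF Suc disc_chain_single] h(2) by metis
  qed
  from this[of n] show ?thesis
    unfolding h(3) \<phi>(4) .
qed

lemma disc_chain_exists:
  fixes \<Omega> :: "(complex^'n) set"
  assumes "domain \<Omega>" "x \<in> \<Omega>" "y \<in> \<Omega>" "0 < \<eta>"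
  shows "\<exists>l. disc_chain \<Omega> \<eta> x y l"
proof (rule connected_equivalence_relation[of \<Omega>])
  show "\<exists>T. openin (top_of_set \<Omega>) T \<and> x \<in> T \<and> (\<forall>y\<in>T. \<exists>l. disc_chain \<Omega> \<eta> x y l)" if x: "x \<in> \<Omega>" for x
  proof -
    obtain r where r: "r > 0" "ball x r \<subseteq> \<Omega>"
      using assms(1) x by (auto simp: domain_def open_contains_ball)
    have "\<exists>l. disc_chain \<Omega> \<eta> x y l" if y: "y \<in> ball x (r/2)" for y
      using disc_step_subdivide[OF disc_step_ball[OF r(2) y] assms(4)] by blast
    moreover have "ball x (r/2) \<subseteq> \<Omega>"
      using r subset_ball[of "r/2" r x] by simp
    ultimately show ?thesis
      using r by (intro exI[of _ "ball x (r/2)"]) (auto intro!: open_subset)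
  qed
qed (use assms in \<open>auto simp: domain_def dest: disc_chain_sym intro: disc_chain_trans\<close>)

text \<open>
  The infimum of the lengths of all chains is itself a pseudodistance, by concatenation and reversal of
  chains, and it lies below the Lempert function, because every disc can be cut into short steps of the
  same total length. So the maximality of \<open>kobayashi\<close> applies to it, for any mesh \<open>\<eta>\<close>.
\<close>

lemma kobayashi_near_chain:
  fixes \<Omega> :: "(complex^'n) set"
  assumes \<Omega>: "domain \<Omega>" "x \<in> \<Omega>" "y \<in> \<Omega>" and \<eta>: "0 < \<eta>" and e: "0 < e"
  shows "\<exists>l < kobayashi \<Omega> x y + e. disc_chain \<Omega> \<eta> x y l"
proof -
  define d where "d u v = Inf {l. disc_chain \<Omega> \<eta> u v l}" for u v :: "complex^'n"
  have bdd: "bdd_below {l. disc_chain \<Omega> \<eta> u v l}" for u v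
    by (rule bdd_belowI[of _ 0]) (auto dest: disc_chain_mem)
  have le: "d u v \<le> l" if "disc_chain \<Omega> \<eta> u v l" for u v l
    unfolding d_def by (rule cInf_lower) (use that bdd in auto)
  have ge: "b \<le> d u v" if "\<And>l. disc_chain \<Omega> \<eta> u v l \<Longrightarrow> b \<le> l" "u \<in> \<Omega>" "v \<in> \<Omega>" for u v b
    unfolding d_def by (rule cInf_greatest) (use that disc_chain_exists[OF \<Omega>(1) that(2,3) \<eta>] in auto)
  have "pseudodistance_on \<Omega> d"
    unfolding pseudodistance_on_def
  proof (intro conjI ballI)
    show nonneg: "0 \<le> d u v" if "u \<in> \<Omega>" "v \<in> \<Omega>" for u v
      by (rule ge[OF _ that]) (auto dest: disc_chain_mem)
    show "d u u = 0" if "u \<in> \<Omega>" for u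
      using nonneg[OF that that] le[OF disc_chain_refl[OF that]] by simp
    show "d u v = d v u" for u v
      unfolding d_def by (rule arg_cong[where f = Inf]) (auto dest: disc_chain_sym)
    show "d u w \<le> d u v + d v w" if uvw: "u \<in> \<Omega>" "v \<in> \<Omega>" "w \<in> \<Omega>" for u v w
    proof -
      have "d u w - l \<le> d v w" if l: "disc_chain \<Omega> \<eta> u v l" for l
        using le[OF disc_chain_trans[OF l]] by (intro ge[OF _ uvw(2,3)]) fastforce
      then have "d u w - d v w \<le> d u v"
        by (intro ge[OF _ uvw(1,2)]) fastforce
      then show ?thesis by simp
    qed
  qed
  then have "d \<in> sub_lempert \<Omega>"
    unfolding sub_lempert_iff using le disc_step_subdivide[OF _ \<eta>] by blast
  then have "d x y < kobayashi \<Omega> x y + e"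
    using kobayashi_greatest(2)[OF \<Omega>(1) _ \<Omega>(2,3)] e by fastforce
  then show ?thesis
    unfolding d_def using disc_chain_exists[OF \<Omega> \<eta>] bdd by (subst (asm) cInf_less_iff) auto
qed

text \<open>
  The vertices as a sequence, so that first, last and closest vertices can be singled out.
\<close>

lemma disc_chain_imp_sequence:
  assumes "disc_chain \<Omega> \<eta> x y l"
  shows "\<exists>N X t. X 0 = x \<and> X N = y \<and> (\<forall>i<N. disc_step \<Omega> (X i) (X (Suc i)) (t i) \<and> t i \<le> \<eta>) \<and>
           l = (\<Sum>i<N. t i)"
  using assms
proof induction
  case (disc_chain_refl x)
  show ?case
    by (intro exI[of _ "0::nat"] exI[of _ "\<lambda>_. x"]) simp
next
  case (disc_chain_step x y t z l)
  then obtain N X s where *: "X 0 = y" "X N = z"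
      "\<forall>i<N. disc_step \<Omega> (X i) (X (Suc i)) (s i) \<and> s i \<le> \<eta>" "l = (\<Sum>i<N. s i)"
    by blast
  have "disc_step \<Omega> (case_nat x X i) (case_nat x X (Suc i)) (case_nat t s i) \<and> case_nat t s i \<le> \<eta>"
    if "i < Suc N" for i
    using that * disc_chain_step.hyps by (cases i) auto
  moreover have "t + l = (\<Sum>i<Suc N. case_nat t s i)"
    unfolding sum.lessThan_Suc_shift using *(4) by simp
  ultimately show ?case
    using *(2) by (intro exI[of _ "Suc N"] exI[of _ "case_nat x X"] exI[of _ "case_nat t s"]) auto
qed

section \<open>Bounded domains and compact subsets\<close>

text \<open>
  The Schwarz lemma for each coordinate of \<open>\<phi> - \<phi> 0\<close>, divided by a bound on its modulus.
\<close>

lemma bounded_discs_Lipschitz_at_centre: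
  fixes \<Omega> :: "(complex^'n) set"
  assumes "bounded \<Omega>"
  obtains \<Lambda> where "0 < \<Lambda>"
    "\<And>\<phi> \<zeta>. holomorphic_disc \<Omega> \<phi> \<Longrightarrow> cmod \<zeta> < 1 \<Longrightarrow> dist (\<phi> 0) (\<phi> \<zeta>) \<le> \<Lambda> * cmod \<zeta>"
proof -
  obtain B where B: "0 < B" "\<And>x. x \<in> \<Omega> \<Longrightarrow> norm x \<le> B"
    using assms by (auto simp: bounded_pos)
  define c where "c = 2 * B + 1"
  have c: "0 < c"
    using B by (simp add: c_def)
  have "dist (\<phi> 0) (\<phi> \<zeta>) \<le> (c * CARD('n)) * cmod \<zeta>"
    if \<phi>: "holomorphic_disc \<Omega> \<phi>" and \<zeta>: "cmod \<zeta> < 1" for \<phi> \<zeta>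
  proof -
    have "cmod (\<phi> \<zeta> $ i - \<phi> 0 $ i) \<le> c * cmod \<zeta>" for i
    proof -
      define f where "f z = (\<phi> z $ i - \<phi> 0 $ i) / c" for z
      have "cmod (f z) < 1" if "cmod z < 1" for z
      proof -
        have "norm (\<phi> z) \<le> B" "norm (\<phi> 0) \<le> B"
          using \<phi> that by (auto intro!: B(2) simp: holomorphic_disc_def)
        then have "cmod (\<phi> z $ i - \<phi> 0 $ i) \<le> 2 * B"
          using norm_triangle_ineq4[of "\<phi> z" "\<phi> 0"] Finite_Cartesian_Product.norm_nth_le[of "\<phi> z - \<phi> 0" i]
          by simp
        then have "cmod (\<phi> z $ i - \<phi> 0 $ i) < c"
          by (simp add: c_def)
        then show ?thesis
          using c by (simp add: f_def norm_divide)
      qed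
      moreover have "f holomorphic_on ball 0 1"
        using \<phi> c unfolding f_def holomorphic_disc_def by (auto intro!: holomorphic_intros)
      ultimately have "cmod (f \<zeta>) \<le> cmod \<zeta>"
        using \<zeta> by (intro Schwarz_Lemma(1)) (simp_all add: f_def[of 0])
      then show ?thesis
        using c by (simp add: f_def norm_divide field_simps)
    qed
    then have "(\<Sum>i\<in>UNIV. cmod ((\<phi> \<zeta> - \<phi> 0) $ i)) \<le> (\<Sum>i\<in>(UNIV::'n set). c * cmod \<zeta>)"
      by (intro sum_mono) simp
    moreover have "norm (\<phi> \<zeta> - \<phi> 0) \<le> (\<Sum>i\<in>UNIV. cmod ((\<phi> \<zeta> - \<phi> 0) $ i))"
      unfolding norm_vec_def by (rule L2_set_le_sum) simp
    ultimately show ?thesis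
      by (simp add: dist_norm norm_minus_commute algebra_simps)
  qed
  then show ?thesis
    using c by (intro that[of "c * CARD('n)"]) auto
qed

text \<open>
  A multiple of the Euclidean distance lies below the Lempert function, hence below \<open>kobayashi\<close>, and
  separates points.
\<close>

lemma kobayashi_bounded_domain_Metric_space:
  fixes \<Omega> :: "(complex^'n) set"
  assumes \<Omega>: "domain \<Omega>" and "bounded \<Omega>" and "X \<subseteq> \<Omega>"
  shows "Metric_space X (kobayashi \<Omega>)"
proof
  fix x y z
  show "0 \<le> kobayashi \<Omega> x y" "kobayashi \<Omega> x y = kobayashi \<Omega> y x"
    by (rule kobayashi_nonneg[OF \<Omega>] kobayashi_commute[OF \<Omega>])+
  assume xy: "x \<in> X" "y \<in> X"
  show "kobayashi \<Omega> x z \<le> kobayashi \<Omega> x y + kobayashi \<Omega> y z" if "z \<in> X"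
    using kobayashi_triangle[OF \<Omega>] xy that assms(3) by blast
  obtain \<Lambda> where \<Lambda>: "0 < \<Lambda>"
    "\<And>\<phi> \<zeta>. holomorphic_disc \<Omega> \<phi> \<Longrightarrow> cmod \<zeta> < 1 \<Longrightarrow> dist (\<phi> 0) (\<phi> \<zeta>) \<le> \<Lambda> * cmod \<zeta>"
    using bounded_discs_Lipschitz_at_centre[OF assms(2)] by metis
  have "dist u v / \<Lambda> \<le> t" if step: "disc_step \<Omega> u v t" for u v t
  proof -
    obtain \<phi> where \<phi>: "0 \<le> t" "holomorphic_disc \<Omega> \<phi>" "\<phi> 0 = u" "\<phi> (of_real (tanh t)) = v"
      using step by (auto simp: disc_step_def)
    then have "dist u v \<le> \<Lambda> * tanh t"
      using \<Lambda>(2)[OF \<phi>(2), of "of_real (tanh t)"] of_real_tanh_in_ball[of t] by simp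
    also have "\<dots> \<le> \<Lambda> * t"
      using \<Lambda>(1) tanh_le_self[OF \<phi>(1)] by simp
    finally show ?thesis
      using \<Lambda>(1) by (simp add: divide_le_eq mult.commute)
  qed
  moreover have "pseudodistance_on \<Omega> (\<lambda>u v. dist u v / \<Lambda>)"
    unfolding pseudodistance_on_def using \<Lambda>(1)
    by (auto simp: dist_commute divide_right_mono dist_triangle simp flip: add_divide_distrib)
  ultimately have "dist x y / \<Lambda> \<le> kobayashi \<Omega> x y"
    using xy assms(3) by (intro kobayashi_greatest(2)[OF \<Omega>]) (auto simp: sub_lempert_iff)
  then show "kobayashi \<Omega> x y = 0 \<longleftrightarrow> x = y"
    using \<Lambda>(1) kobayashi_refl[OF \<Omega>] by (auto simp: divide_le_0_iff)
qed

text \<open>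
  Finitely many half-radius balls cover the compact set, and each of their points is one disc step
  away from the centre of its ball.
\<close>

lemma kobayashi_bounded_on_compact:
  fixes \<Omega> :: "(complex^'n) set"
  assumes \<Omega>: "domain \<Omega>" and C: "compact C" "C \<subseteq> \<Omega>"
  obtains M where "0 \<le> M" "\<And>x y. x \<in> C \<Longrightarrow> y \<in> C \<Longrightarrow> kobayashi \<Omega> x y \<le> M"
proof -
  have "\<exists>r>0. ball x r \<subseteq> \<Omega>" if "x \<in> C" for x
    using \<Omega> C that by (auto simp: domain_def open_contains_ball)
  then obtain r where r: "\<And>x. x \<in> C \<Longrightarrow> 0 < r x" "\<And>x. x \<in> C \<Longrightarrow> ball x (r x) \<subseteq> \<Omega>"
    by metis
  have "C \<subseteq> (\<Union>x\<in>C. ball x (r x / 2))"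
    using r(1) by fastforce
  then obtain F where F: "F \<subseteq> C" "finite F" "C \<subseteq> (\<Union>x\<in>F. ball x (r x / 2))"
    using compactE_image[OF C(1), of C "\<lambda>x. ball x (r x / 2)"] by auto
  define A where "A = artanh (1 / 2 :: real)"
  obtain B where B: "\<And>p q. p \<in> F \<Longrightarrow> q \<in> F \<Longrightarrow> kobayashi \<Omega> p q \<le> B"
  proof -
    have "bdd_above ((\<lambda>(p, q). kobayashi \<Omega> p q) ` (F \<times> F))"
      using F(2) by (intro bdd_above_finite) auto
    then show ?thesis
      using that by (auto simp: bdd_above_def)
  qed
  have "kobayashi \<Omega> x y \<le> B + 2 * A" if xy: "x \<in> C" "y \<in> C" for x y
  proof -
    obtain p q where pq: "p \<in> F" "x \<in> ball p (r p / 2)" "q \<in> F" "y \<in> ball q (r q / 2)"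
      using F(3) xy by blast
    then have "kobayashi \<Omega> p x \<le> A" "kobayashi \<Omega> q y \<le> A"
      unfolding A_def using F(1) r(2) kobayashi_le_step[OF \<Omega> disc_step_ball] by blast+
    moreover have "x \<in> \<Omega>" "y \<in> \<Omega>" "p \<in> \<Omega>" "q \<in> \<Omega>"
      using xy pq(1,3) F(1) C(2) by auto
    ultimately show ?thesis
      using kobayashi_triangle[OF \<Omega>, of x p y] kobayashi_triangle[OF \<Omega>, of p q y]
        kobayashi_commute[OF \<Omega>, of x p] B[OF pq(1,3)] by linarith
  qed
  then show ?thesis
    by (intro that[of "max 0 (B + 2 * A)"]) (auto simp: max.coboundedI2)
qed

section \<open>Connectedness of the complement\<close>

lemma complex_line_translates:
  assumes "complex_line L" "z \<in> L"
  obtains v where "norm v = 1" "\<And>t. z + t *s v \<in> L"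
proof -
  obtain a v where av: "v \<noteq> 0" "L = {a + t *s v | t. True}"
    using assms(1) by (auto simp: complex_line_def)
  obtain s where s: "z = a + s *s v"
    using assms(2) av by auto
  define w where "w = of_real (1 / norm v) *s v"
  have "norm w = 1"
    using av(1) by (simp add: w_def norm_vector_smult norm_divide)
  moreover have "z + t *s w \<in> L" for t
  proof -
    have "z + t *s w = a + (s + t * of_real (1 / norm v)) *s v"
      by (simp add: s w_def vec_eq_iff algebra_simps)
    then show ?thesis
      unfolding av(2) by blast
  qed
  ultimately show ?thesis
    by (rule that)
qed

text \<open>
  A complex line through a point of the complement reaches the outside of a ball that contains
  \<open>K\<close>. That outside is connected, as the real dimension is at least two.
\<close>

lemma complement_connected_if_lines_escape:
  fixes K :: "(complex^'n) set"
  assumes K: "bounded K"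
    and lines: "\<And>z. z \<notin> K \<Longrightarrow> \<exists>L. complex_line L \<and> z \<in> L \<and> L \<inter> K = {}"
  shows "connected (- K)"
proof -
  obtain B where B: "K \<subseteq> cball 0 B" "0 < B"
    using K by (auto simp: bounded_pos subset_iff)
  have "1 \<le> CARD('n)"
    by (simp add: Suc_leI)
  then have out: "connected (- cball (0 :: complex^'n) B)"
    by (intro connected_complement_bounded_convex) (auto)
  have escape: "\<exists>w. w \<in> - cball 0 B \<and> connected_component (- K) z w" if z: "z \<in> - K" for z
  proof -
    obtain L where L: "complex_line L" "z \<in> L" "L \<inter> K = {}"
      using lines z by blast
    obtain v where v: "norm v = 1" "\<And>t. z + t *s v \<in> L"
      using complex_line_translates[OF L(1,2)] by metis
    define f where "f t = z + of_real t *s v" for t :: real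
    have "f = (\<lambda>t. z + t *\<^sub>R v)"
      by (simp add: f_def fun_eq_iff vec_eq_iff scaleR_conv_of_real[where 'a = complex])
    then have "continuous_on UNIV f"
      by (auto intro!: continuous_intros)
    then have "connected (range f)"
      by (rule connected_continuous_image) simp
    moreover have "range f \<subseteq> - K"
      using v(2) L(3) by (auto simp: f_def)
    moreover have "z = f 0"
      by (simp add: f_def)
    ultimately have "connected_component (- K) z (f (norm z + B + 1))"
      unfolding connected_component_def by blast
    moreover have "norm (f t - z) = \<bar>t\<bar>" for t
      by (simp add: f_def norm_vector_smult v(1))
    then have "norm (f (norm z + B + 1)) > B"
      using norm_triangle_ineq4[of "f (norm z + B + 1)" z] B(2)
      by (smt (verit) norm_ge_zero)
    ultimately show ?thesis
      by (intro exI[of _ "f (norm z + B + 1)"]) auto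
  qed
  have "connected_component (- K) z w" if zw: "z \<in> - K" "w \<in> - K" for z w
  proof -
    obtain z' w' where *: "z' \<in> - cball 0 B" "connected_component (- K) z z'"
      "w' \<in> - cball 0 B" "connected_component (- K) w w'"
      using escape zw by metis
    then have "connected_component (- K) z' w'"
      unfolding connected_component_def using out B(1) by blast
    then show ?thesis
      using * by (meson connected_component_sym connected_component_trans)
  qed
  then show ?thesis
    by (simp add: connected_iff_connected_component)
qed

lemma domain_Diff_compact:
  fixes G K :: "'a::euclidean_space set"
  assumes "domain G" "compact K" "K \<subseteq> G" "connected (- K)"
  shows "domain (G - K)"
  unfolding domain_def
proof (intro conjI)
  show "open (G - K)"
    using assms by (simp add: domain_def compact_imp_closed open_Diff)
  show "G - K \<noteq> {}"
    using assms compact_open[of G] by (auto simp: domain_def)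
  have "connected_component (G - K) a b" if "a \<in> G - K" "b \<in> G - K" for a b
  proof -
    have "connected_component (- K) a b" "connected_component (- (- G)) a b"
      using that assms unfolding domain_def connected_component_def double_complement by blast+
    then have "connected_component (- (K \<union> - G)) a b"
      using assms by (intro separation_by_Un_closed_pointwise)
        (auto simp: domain_def compact_imp_closed)
    moreover have "- (K \<union> - G) = G - K"
      by blast
    ultimately show ?thesis
      by simp
  qed
  then show "connected (G - K)"
    by (simp add: connected_iff_connected_component)
qed

section \<open>The part near the removed compact set has finite diameter\<close>

text \<open>
  Walk along the line through \<open>z\<close> in steps of length \<open>\<delta> / 2\<close>. As long as the walk is
  \<open>\<delta>\<close>-near \<open>K\<close>, the round disc of radius \<open>\<delta>\<close> in the line stays in \<open>\<Omega>\<close>, because the line misses \<open>K\<close>,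
  so each step has hyperbolic length \<open>artanh (1 / 2)\<close> at most. The number of steps is bounded by the
  size of \<open>K\<close>. The first vertex that is no longer \<open>\<delta>\<close>-near cannot have jumped over the shell.
\<close>

lemma line_escape_bounded_length:
  fixes \<Omega> K :: "(complex^'n) set"
  assumes \<Omega>: "domain \<Omega>" and K: "compact K" "K \<noteq> {}"
    and lines: "\<And>z. z \<notin> K \<Longrightarrow> \<exists>L. complex_line L \<and> z \<in> L \<and> L \<inter> K = {}"
    and \<delta>: "0 < \<delta>" and nbhd: "\<And>z. infdist z K \<le> 2 * \<delta> \<Longrightarrow> z \<notin> K \<Longrightarrow> z \<in> \<Omega>"
  obtains M where "0 \<le> M"
    "\<And>z. z \<notin> K \<Longrightarrow> infdist z K < \<delta> \<Longrightarrow>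
       \<exists>w. \<delta> \<le> infdist w K \<and> infdist w K \<le> 2 * \<delta> \<and> kobayashi \<Omega> z w \<le> M"
proof -
  define A where "A = artanh (1 / 2 :: real)"
  have A: "0 \<le> A"
    by (simp add: A_def artanh_def)
  obtain B where B: "0 < B" "\<And>x. x \<in> K \<Longrightarrow> norm x \<le> B"
    using compact_imp_bounded[OF K(1)] by (auto simp: bounded_pos)
  obtain N :: nat where N: "(2 * B + 2 * \<delta>) / (\<delta> / 2) < N"
    using reals_Archimedean2 by blast
  \<comment> \<open>The start has norm at most \<open>B + \<delta>\<close>, so after \<open>N\<close> steps the walk is at distance at least \<open>\<delta>\<close> from
    the ball of radius \<open>B\<close>.\<close>
  have far: "2 * B + 2 * \<delta> < N * (\<delta> / 2)"
    using N \<delta> by (subst (asm) pos_divide_less_eq) auto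
  have attains: "\<exists>b\<in>K. infdist z K = dist z b" for z
    using infdist_attains_inf[OF compact_imp_closed[OF K(1)] K(2)] by metis
  have "\<exists>w. \<delta> \<le> infdist w K \<and> infdist w K \<le> 2 * \<delta> \<and> kobayashi \<Omega> z w \<le> N * A"
    if z: "z \<notin> K" "infdist z K < \<delta>" for z
  proof -
    obtain L where L: "complex_line L" "z \<in> L" "L \<inter> K = {}"
      using lines[OF z(1)] by blast
    obtain v where v: "norm v = 1" "\<And>t. z + t *s v \<in> L"
      using complex_line_translates[OF L(1,2)] by metis
    define w where "w j = z + of_real (j * (\<delta> / 2)) *s v" for j :: nat
    have avoid: "z + t *s v \<notin> K" for t
      using v(2) L(3) by blast
    then have w_avoid: "w j \<notin> K" for j
      by (simp add: w_def)
    have w_Suc: "w (Suc j) = w j + (of_real \<delta> * (1 / 2)) *s v" for j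
      by (simp add: w_def vec_eq_iff algebra_simps)
    have w_0: "w 0 = z"
      by (simp add: w_def)
    have norm_z: "norm z \<le> B + \<delta>"
    proof -
      obtain b where "b \<in> K" "infdist z K = dist z b"
        using attains by blast
      then show ?thesis
        using z(2) B(2)[of b] norm_triangle_sub[of z b] by (simp add: dist_norm)
    qed
    have w_N: "\<delta> \<le> infdist (w N) K"
    proof -
      obtain b where b: "b \<in> K" "infdist (w N) K = dist (w N) b"
        using attains by blast
      have "N * (\<delta> / 2) = norm (w N - z)"
        using \<delta> by (simp add: w_def norm_vector_smult v(1) norm_mult norm_divide)
      also have "\<dots> \<le> norm (w N - b) + norm b + norm z"
        using norm_triangle_ineq4[of "w N" z] norm_triangle_sub[of "w N" b] by linarith
      finally show ?thesis
        using far norm_z B(2)[OF b(1)] b(2) by (simp add: dist_norm)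
    qed
    define p where "p = (LEAST j. \<delta> \<le> infdist (w j) K)"
    have p: "\<delta> \<le> infdist (w p) K" "p \<le> N" "\<And>j. j < p \<Longrightarrow> infdist (w j) K < \<delta>"
      unfolding p_def
      by (rule LeastI[of _ N], rule w_N, rule Least_le, rule w_N, drule not_less_Least, simp)
    have step: "disc_step \<Omega> (w j) (w (Suc j)) A" if j: "j < p" for j
    proof -
      have "w j + (of_real \<delta> * \<zeta>) *s v \<in> \<Omega>" if \<zeta>: "cmod \<zeta> < 1" for \<zeta>
      proof (rule nbhd)
        have "dist (w j + (of_real \<delta> * \<zeta>) *s v) (w j) \<le> \<delta>"
          using \<delta> \<zeta> by (simp add: dist_norm norm_vector_smult v(1) norm_mult)
        then show "infdist (w j + (of_real \<delta> * \<zeta>) *s v) K \<le> 2 * \<delta>"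
          using infdist_triangle[of "w j + (of_real \<delta> * \<zeta>) *s v" K "w j"] p(3)[OF j] by linarith
        have "w j + (of_real \<delta> * \<zeta>) *s v = z + (of_real (j * (\<delta> / 2)) + of_real \<delta> * \<zeta>) *s v"
          by (simp add: w_def vec_eq_iff algebra_simps)
        then show "w j + (of_real \<delta> * \<zeta>) *s v \<notin> K"
          using avoid by metis
      qed
      from disc_step_along_line[OF this, of "1 / 2"] show ?thesis
        by (simp add: w_Suc A_def norm_divide)
    qed
    have "z \<in> \<Omega>"
      using nbhd[of z] z \<delta> by simp
    have walk: "w j \<in> \<Omega> \<and> kobayashi \<Omega> z (w j) \<le> j * A" if "j \<le> p" for j
      using that
    proof (induction j)
      case 0
      then show ?case
        using \<open>z \<in> \<Omega>\<close> kobayashi_refl[OF \<Omega>] by (simp add: w_0)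
    next
      case (Suc j)
      then have IH: "w j \<in> \<Omega>" "kobayashi \<Omega> z (w j) \<le> j * A" and st: "disc_step \<Omega> (w j) (w (Suc j)) A"
        using step by auto
      have "kobayashi \<Omega> z (w (Suc j)) \<le> kobayashi \<Omega> z (w j) + A"
        using kobayashi_triangle[OF \<Omega> \<open>z \<in> \<Omega>\<close> IH(1) disc_step_mem(3)[OF st]]
          kobayashi_le_step[OF \<Omega> st] by linarith
      also have "\<dots> \<le> Suc j * A"
        using IH(2) by (simp add: algebra_simps)
      finally show ?case
        using disc_step_mem(3)[OF st] by simp
    qed
    have "kobayashi \<Omega> z (w p) \<le> N * A"
      using walk[of p] mult_right_mono[of "real p" "real N" A] p(2) A by linarith
    moreover have "infdist (w p) K \<le> 2 * \<delta>"
    proof -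
      have "p \<noteq> 0"
        using p(1) z(2) w_0 by (metis not_le)
      then obtain j where j: "p = Suc j"
        using not0_implies_Suc by blast
      have "dist (w p) (w j) \<le> \<delta>"
        using \<delta> by (simp add: j w_Suc dist_norm norm_vector_smult v(1) norm_mult norm_divide)
      then show ?thesis
        using infdist_triangle[of "w p" K "w j"] p(3)[of j] j by simp
    qed
    ultimately show ?thesis
      using p(1) by blast
  qed
  then show ?thesis
    using A by (intro that[of "N * A"]) auto
qed

text \<open>
  Both points escape to the shell \<open>S\<close>, which is a compact subset of the domain \<open>G - K\<close>.
\<close>

lemma kobayashi_bounded_near_removed_compact:
  fixes G K :: "(complex^'n) set"
  assumes GK: "domain (G - K)" and K: "compact K" "K \<noteq> {}"
    and lines: "\<And>z. z \<notin> K \<Longrightarrow> \<exists>L. complex_line L \<and> z \<in> L \<and> L \<inter> K = {}"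
    and \<delta>: "0 < \<delta>" and nbhd: "\<And>z. infdist z K \<le> 2 * \<delta> \<Longrightarrow> z \<in> G"
  obtains M where "0 \<le> M"
    "\<And>z w. z \<notin> K \<Longrightarrow> infdist z K < \<delta> \<Longrightarrow> w \<notin> K \<Longrightarrow> infdist w K < \<delta> \<Longrightarrow>
       kobayashi (G - K) z w \<le> M"
proof -
  let ?k = "kobayashi (G - K)"
  define S where "S = {w. infdist w K \<le> 2 * \<delta>} \<inter> {w. \<delta> \<le> infdist w K}"
  have "compact S"
    unfolding S_def using K \<delta>
    by (intro compact_Int_closed compact_infdist_le closed_Collect_le continuous_intros) auto
  moreover have "S \<subseteq> G - K"
    using nbhd \<delta> by (auto simp: S_def)
  ultimately obtain M1 where M1: "0 \<le> M1" "\<And>x y. x \<in> S \<Longrightarrow> y \<in> S \<Longrightarrow> ?k x y \<le> M1"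
    using kobayashi_bounded_on_compact[OF GK] by metis
  obtain M2 where M2: "0 \<le> M2"
    "\<And>z. z \<notin> K \<Longrightarrow> infdist z K < \<delta> \<Longrightarrow> \<exists>w. \<delta> \<le> infdist w K \<and> infdist w K \<le> 2 * \<delta> \<and> ?k z w \<le> M2"
    using line_escape_bounded_length[OF GK K lines \<delta>] nbhd by (metis DiffI)
  show ?thesis
  proof (rule that[of "M1 + 2 * M2"])
    fix z w assume zw: "z \<notin> K" "infdist z K < \<delta>" "w \<notin> K" "infdist w K < \<delta>"
    obtain z' w' where *: "z' \<in> S" "?k z z' \<le> M2" "w' \<in> S" "?k w w' \<le> M2"
      using M2(2)[OF zw(1,2)] M2(2)[OF zw(3,4)] by (auto simp: S_def)
    have mem: "z \<in> G - K" "w \<in> G - K" "z' \<in> G - K" "w' \<in> G - K"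
      using zw nbhd \<delta> * \<open>S \<subseteq> G - K\<close> by auto
    show "?k z w \<le> M1 + 2 * M2"
      using kobayashi_triangle[OF GK mem(1,3,2)] kobayashi_triangle[OF GK mem(3,4,2)]
        kobayashi_commute[OF GK, of w' w] M1(2)[OF *(1,3)] *(2,4) by linarith
  qed (use M1 M2 in simp)
qed

section \<open>Rescaling discs so that they avoid the removed set\<close>

text \<open>
  A disc centred at \<open>x\<close> avoids \<open>K\<close> on the radius \<open>r\<close> that is the larger of two bounds: \<open>r0\<close>, since the
  disc cannot move fast in the Euclidean metric, and \<open>tanh R\<close>, since reaching \<open>K\<close> costs
  Kobayashi distance \<open>R\<close>. The first keeps the rescaled parameter \<open>tanh t / r\<close> below \<open>1 / 2\<close>, where
  \<open>artanh\<close> has derivative at most \<open>4 / 3\<close>; the second makes \<open>1 - r\<close> exponentially small.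
\<close>

lemma kobayashi_Diff_step_le:
  fixes G K :: "(complex^'n) set"
  assumes G: "domain G" and GK: "domain (G - K)" and a: "a \<in> G"
    and M: "\<And>b. b \<in> K \<Longrightarrow> kobayashi G b a \<le> M"
    and \<Lambda>: "0 < \<Lambda>"
      "\<And>\<phi> \<zeta>. holomorphic_disc G \<phi> \<Longrightarrow> cmod \<zeta> < 1 \<Longrightarrow> dist (\<phi> 0) (\<phi> \<zeta>) \<le> \<Lambda> * cmod \<zeta>"
    and r0: "0 < r0" "r0 < 1" and far: "\<And>b. b \<in> K \<Longrightarrow> \<Lambda> * r0 \<le> dist x b"
    and step: "disc_step G x y t" "t \<le> r0 / 2"
  shows "y \<in> G - K"
    and "kobayashi (G - K) x y \<le> t + 8 * exp (2 * M) / (3 * r0) * (t * exp (- 2 * kobayashi G x a))"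
proof -
  obtain \<phi> where \<phi>: "0 \<le> t" "holomorphic_disc G \<phi>" "\<phi> 0 = x" "\<phi> (of_real (tanh t)) = y"
    using step(1) by (auto simp: disc_step_def)
  define R where "R = kobayashi G x a - M"
  define r where "r = max r0 (tanh R)"
  have r: "0 < r" "r < 1" "r0 \<le> r" "tanh R \<le> r"
    using r0 tanh_real_lt_1[of R] by (auto simp: r_def)
  have avoid: "\<phi> \<zeta> \<notin> K" if \<zeta>: "cmod \<zeta> < r" for \<zeta>
  proof
    assume b: "\<phi> \<zeta> \<in> K"
    have \<zeta>1: "cmod \<zeta> < 1"
      using \<zeta> r by linarith
    have "\<Lambda> * r0 \<le> \<Lambda> * cmod \<zeta>"
      using far[OF b] \<Lambda>(2)[OF \<phi>(2) \<zeta>1] \<phi>(3) by simp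
    then have "r0 \<le> cmod \<zeta>"
      using \<Lambda>(1) by simp
    moreover have "tanh R \<le> cmod \<zeta>"
    proof -
      have st: "disc_step G x (\<phi> \<zeta>) (artanh (cmod \<zeta>))"
        using disc_stepI[OF \<phi>(2) \<zeta>1] \<phi>(3) by simp
      have "kobayashi G x a \<le> artanh (cmod \<zeta>) + M"
        using kobayashi_triangle[OF G disc_step_mem(2,3)[OF st] a] kobayashi_le_step[OF G st] M[OF b]
        by linarith
      then have "tanh R \<le> tanh (artanh (cmod \<zeta>))"
        by (simp add: R_def)
      then show ?thesis
        using \<zeta>1 by (simp add: tanh_artanh_real)
    qed
    ultimately show False
      using \<zeta> by (simp add: r_def)
  qed
  define \<psi> where "\<psi> = \<phi> \<circ> (\<lambda>\<zeta>. of_real r * \<zeta>)"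
  have shrink: "cmod (of_real r * \<zeta>) < r" if "cmod \<zeta> < 1" for \<zeta>
    using that r by (simp add: norm_mult)
  have "holomorphic_disc G \<psi>"
    unfolding \<psi>_def using shrink r
    by (intro holomorphic_disc_compose[OF \<phi>(2)]) (fastforce intro!: holomorphic_intros)+
  then have \<psi>: "holomorphic_disc (G - K) \<psi>"
    using avoid[OF shrink] by (auto simp: holomorphic_disc_def \<psi>_def)
  define s where "s = tanh t"
  have s: "0 \<le> s" "s \<le> t" "s \<le> r / 2" "artanh s = t"
    using tanh_le_self[OF \<phi>(1)] \<phi>(1) step(2) r(3) by (auto simp: s_def artanh_tanh_real)
  have sr: "0 \<le> s / r" "s \<le> s / r" "s / r \<le> 1 / 2"
    using s r by (auto simp: pos_le_divide_eq pos_divide_le_eq mult_left_le)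
  have new_step: "disc_step (G - K) x y (artanh (s / r))"
  proof -
    have "cmod (of_real (s / r)) = s / r"
      unfolding norm_of_real using sr(1) by (rule abs_of_nonneg)
    moreover have "\<psi> 0 = x" "\<psi> (of_real (s / r)) = y"
      using \<phi>(3,4) r(1) by (simp_all add: \<psi>_def s_def)
    ultimately show ?thesis
      using disc_stepI[OF \<psi>, of "of_real (s / r)"] sr(3) by simp
  qed
  show "y \<in> G - K"
    by (rule disc_step_mem(3)[OF new_step])
  have le: "kobayashi (G - K) x y \<le> artanh (s / r)"
    by (rule kobayashi_le_step[OF GK new_step])
  have "artanh (s / r) - t \<le> (s / r - s) / (1 - (s / r)\<^sup>2)"
    using artanh_diff_bounds(2)[of s "s / r"] s sr by simp
  also have "\<dots> \<le> (s / r - s) / (3 / 4)"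
  proof (rule divide_left_mono)
    have "(s / r)\<^sup>2 \<le> (1 / 2)\<^sup>2"
      using sr by (intro power_mono) auto
    then show "3 / 4 \<le> 1 - (s / r)\<^sup>2"
      by (simp add: power2_eq_square)
    then show "0 < (1 - (s / r)\<^sup>2) * (3 / 4)"
      by simp
  qed (use sr in simp)
  also have "s / r - s = s * (1 - r) / r"
    using r by (simp add: field_simps)
  also have "\<dots> \<le> t * (2 * exp (- 2 * R)) / r0"
    using s r r0 one_minus_tanh_le[of R]
    by (intro frac_le mult_mono) auto
  also have "exp (- 2 * R) = exp (2 * M) * exp (- 2 * kobayashi G x a)"
    by (simp add: R_def algebra_simps flip: exp_add)
  finally show "kobayashi (G - K) x y \<le>
      t + 8 * exp (2 * M) / (3 * r0) * (t * exp (- 2 * kobayashi G x a))"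
    using le by (simp add: divide_right_mono algebra_simps)
qed

section \<open>The error along an almost geodesic chain\<close>

text \<open>
  The primitive of \<open>exp (- \<bar>u\<bar>)\<close> has a kink in its derivative at 0. The smooth bounded function
  \<open>2 * arctan\<close> serves instead: its derivative \<open>2 / (1 + z\<^sup>2)\<close> dominates \<open>exp (- \<bar>u\<bar>)\<close> even when \<open>z\<close> is only
  within distance 1 of \<open>u\<close>.
\<close>

lemma exp_decay_le_arctan_diff:
  fixes u h :: real
  assumes h: "0 \<le> h" "h \<le> 1"
  shows "h * exp (- \<bar>u\<bar>) \<le> 2 * (arctan (u + h) - arctan u)"
proof (cases "h = 0")
  case False
  then have "\<exists>z. u < z \<and> z < u + h \<and> arctan (u + h) - arctan u = (u + h - u) * inverse (1 + z\<^sup>2)"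
    using h by (intro MVT2 DERIV_arctan) auto
  then obtain z where z: "u < z" "z < u + h"
      "arctan (u + h) - arctan u = h * inverse (1 + z\<^sup>2)"
    by auto
  have "z\<^sup>2 \<le> (\<bar>u\<bar> + 1)\<^sup>2"
    using z h by (intro power2_le_iff_abs_le[THEN iffD2]) auto
  also have "1 + (\<bar>u\<bar> + 1)\<^sup>2 \<le> 2 * exp \<bar>u\<bar>"
    using exp_lower_Taylor_quadratic[of "\<bar>u\<bar>"] by (simp add: power2_eq_square algebra_simps)
  finally have "1 + z\<^sup>2 \<le> 2 * exp \<bar>u\<bar>"
    by simp
  then have "exp (- \<bar>u\<bar>) \<le> 2 * inverse (1 + z\<^sup>2)"
    by (simp add: exp_minus field_simps add_pos_nonneg)
  from mult_left_mono[OF this h(1)] show ?thesis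
    unfolding z(3) by (simp add: mult.left_commute)
qed simp

text \<open>
  A Riemann sum of mesh at most 1 for the integral of the exponential decay around \<open>c\<close>, with nodes the
  partial sums of \<open>t\<close>; the bounds by \<open>arctan\<close> telescope.
\<close>

lemma sum_exp_decay_le_2pi:
  fixes t :: "nat \<Rightarrow> real" and c :: real
  assumes t: "\<And>i. i < N \<Longrightarrow> 0 \<le> t i \<and> t i \<le> 1"
  shows "(\<Sum>i<N. t i * exp (- \<bar>(\<Sum>j<i. t j) - c\<bar>)) \<le> 2 * pi"
proof -
  have "n \<le> N \<Longrightarrow> (\<Sum>i<n. t i * exp (- \<bar>(\<Sum>j<i. t j) - c\<bar>)) \<le>
      2 * (arctan ((\<Sum>j<n. t j) - c) - arctan (- c))" for n
  proof (induction n)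
    case (Suc n)
    then show ?case
      using exp_decay_le_arctan_diff[of "t n" "(\<Sum>j<n. t j) - c"] t[of n]
      by (simp add: algebra_simps)
  qed simp
  from this[of N] show ?thesis
    using arctan_ubound[of "(\<Sum>j<N. t j) - c"] arctan_lbound[of "- c"] by simp
qed

text \<open>
  With \<open>m\<close> the index at which the distance to \<open>a\<close> is smallest,
  \<open>2 * k (X i) a \<ge> k (X i) a + k (X m) a \<ge> k (X i) (X m) \<ge> \<bar>s i - s m\<bar> - 1\<close>, where \<open>k\<close> is the
  distance and \<open>s\<close> the arc length along the chain; the last inequality holds because the chain exceeds
  the distance of its ends by at most 1.
\<close>

lemma near_geodesic_exp_decay:
  fixes \<Omega> :: "(complex^'n) set" and X :: "nat \<Rightarrow> complex^'n"
  assumes \<Omega>: "domain \<Omega>" and a: "a \<in> \<Omega>" and N: "0 < N"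
    and step: "\<And>i. i < N \<Longrightarrow> disc_step \<Omega> (X i) (X (Suc i)) (t i) \<and> t i \<le> 1"
    and near: "(\<Sum>i<N. t i) \<le> kobayashi \<Omega> (X 0) (X N) + 1"
  shows "(\<Sum>i<N. t i * exp (- 2 * kobayashi \<Omega> (X i) a)) \<le> 2 * pi * exp 1"
proof -
  let ?k = "kobayashi \<Omega>"
  define s where "s n = (\<Sum>i<n. t i)" for n
  have mem: "X i \<in> \<Omega>" if "i \<le> N" for i
  proof (cases i)
    case 0
    then show ?thesis
      using disc_step_mem(2)[of \<Omega> "X 0"] step[OF N] by blast
  next
    case (Suc j)
    then show ?thesis
      using disc_step_mem(3)[of \<Omega> "X j" "X i"] step[of j] that by auto
  qed
  have seg: "?k (X i) (X j) \<le> s j - s i" if "i \<le> j" "j \<le> N" for i j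
    using that
  proof (induction j rule: dec_induct)
    case base
    then show ?case
      by (simp add: kobayashi_refl[OF \<Omega>])
  next
    case (step j)
    have "?k (X i) (X (Suc j)) \<le> ?k (X i) (X j) + ?k (X j) (X (Suc j))"
      using step by (intro kobayashi_triangle[OF \<Omega>] mem) auto
    moreover have "?k (X j) (X (Suc j)) \<le> t j"
      using step assms(4)[of j] by (intro kobayashi_le_step[OF \<Omega>]) auto
    ultimately show ?case
      using step by (simp add: s_def)
  qed
  have far: "\<bar>s i - s j\<bar> - 1 \<le> ?k (X i) (X j)" if "i \<le> N" "j \<le> N" for i j
  proof -
    have *: "s j - s i - 1 \<le> ?k (X i) (X j)" if "i \<le> j" "j \<le> N" for i j
    proof -
      have "?k (X 0) (X N) \<le> ?k (X 0) (X i) + (?k (X i) (X j) + ?k (X j) (X N))"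
        using kobayashi_triangle[OF \<Omega>, of "X 0" "X i" "X N"] kobayashi_triangle[OF \<Omega>, of "X i" "X j" "X N"]
          mem that by fastforce
      then show ?thesis
        using seg[of 0 i] seg[of j N] near that by (simp add: s_def)
    qed
    have s_mono: "0 \<le> s j - s i" if "i \<le> j" "j \<le> N" for i j
      using seg[OF that] kobayashi_nonneg[OF \<Omega>, of "X i" "X j"] by linarith
    show ?thesis
    proof (cases "i \<le> j")
      case True
      then show ?thesis
        using *[OF True that(2)] s_mono[OF True that(2)] by simp
    next
      case False
      then have "j \<le> i"
        by simp
      then show ?thesis
        using *[of j i] s_mono[of j i] kobayashi_commute[OF \<Omega>, of "X i" "X j"] that(1) by simp
    qed
  qed
  obtain m where m: "m \<le> N" "\<And>i. i \<le> N \<Longrightarrow> ?k (X m) a \<le> ?k (X i) a"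
  proof -
    define I where "I = (\<lambda>i. ?k (X i) a) ` {..N}"
    have I: "finite I" "I \<noteq> {}"
      by (auto simp: I_def)
    have "\<exists>j\<le>N. ?k (X j) a = v" if "v \<in> I" for v
      using that by (auto simp: I_def)
    then obtain j where j: "j \<le> N" "?k (X j) a = Min I"
      using Min_in[OF I] by blast
    have "?k (X j) a \<le> ?k (X i) a" if "i \<le> N" for i
      unfolding j(2) by (rule Min_le[OF I(1)]) (use that in \<open>simp add: I_def\<close>)
    with j(1) show ?thesis
      by (rule that)
  qed
  have "t i * exp (- 2 * ?k (X i) a) \<le> exp 1 * (t i * exp (- \<bar>s i - s m\<bar>))" if i: "i < N" for i
  proof -
    have "?k (X i) (X m) \<le> ?k (X i) a + ?k (X m) a"
      using kobayashi_triangle[OF \<Omega>, of "X i" a "X m"] mem[of i] mem[OF m(1)] a i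
        kobayashi_commute[OF \<Omega>, of a "X m"] by simp
    then have "- 2 * ?k (X i) a \<le> 1 + - \<bar>s i - s m\<bar>"
      using far[of i m] m(1) m(2)[of i] i by linarith
    then have "exp (- 2 * ?k (X i) a) \<le> exp 1 * exp (- \<bar>s i - s m\<bar>)"
      unfolding exp_add[symmetric] by simp
    moreover have "0 \<le> t i"
      using step[OF i] disc_step_mem(1) by blast
    ultimately show ?thesis
      using mult_left_mono by (metis mult.left_commute)
  qed
  then have "(\<Sum>i<N. t i * exp (- 2 * ?k (X i) a)) \<le> (\<Sum>i<N. exp 1 * (t i * exp (- \<bar>s i - s m\<bar>)))"
    by (intro sum_mono) simp
  also have "\<dots> = exp 1 * (\<Sum>i<N. t i * exp (- \<bar>s i - s m\<bar>))"
    by (simp add: sum_distrib_left)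
  also have "\<dots> \<le> exp 1 * (2 * pi)"
    unfolding s_def using step disc_step_mem(1)
    by (intro mult_left_mono sum_exp_decay_le_2pi) (blast, simp)
  finally show ?thesis
    by (simp add: mult.commute)
qed

section \<open>Comparison of the two distances\<close>

text \<open>
  Along an almost shortest chain in \<open>G\<close>, steps with an end that is not \<open>\<delta>\<close>-near \<open>K\<close> are rescaled around
  that end. If there are \<open>\<delta>\<close>-near vertices, the first of them, \<open>p\<close>, is reached from \<open>x\<close> by such steps
  taken forwards, and the last of them, \<open>q\<close>, from \<open>y\<close> by such steps taken backwards. Everything
  in between is replaced by the diameter bound \<open>M'\<close>. The vertices between \<open>p\<close> and \<open>q\<close> may lie in \<open>K\<close>,
  but \<open>p\<close> and \<open>q\<close> do not, since each is an end of the chain or the end of a rescaled disc in \<open>G - K\<close>.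
\<close>

lemma kobayashi_Diff_le_add_const:
  fixes G K :: "(complex^'n) set"
  assumes G: "domain G" "bounded G" and GK: "domain (G - K)"
    and K: "compact K" "K \<noteq> {}" "K \<subseteq> G"
    and lines: "\<And>z. z \<notin> K \<Longrightarrow> \<exists>L. complex_line L \<and> z \<in> L \<and> L \<inter> K = {}"
  obtains C where "0 < C"
    "\<And>x y. x \<in> G - K \<Longrightarrow> y \<in> G - K \<Longrightarrow> kobayashi (G - K) x y \<le> kobayashi G x y + C"
proof -
  let ?k = "kobayashi G" and ?k' = "kobayashi (G - K)"
  obtain \<epsilon> where \<epsilon>: "0 < \<epsilon>" "(\<Union>x\<in>K. cball x \<epsilon>) \<subseteq> G"
    using compact_subset_open_imp_cball_epsilon_subset[OF K(1) _ K(3)] G(1) by (auto simp: domain_def)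
  define \<delta> where "\<delta> = \<epsilon> / 2"
  have \<delta>: "0 < \<delta>"
    using \<epsilon>(1) by (simp add: \<delta>_def)
  have nbhd: "z \<in> G" if "infdist z K \<le> 2 * \<delta>" for z
  proof -
    obtain b where "b \<in> K" "infdist z K = dist z b"
      using infdist_attains_inf[OF compact_imp_closed[OF K(1)] K(2)] by metis
    then have "b \<in> K" "z \<in> cball b \<epsilon>"
      using that by (simp_all add: \<delta>_def dist_commute)
    then show ?thesis
      using \<epsilon>(2) by blast
  qed
  obtain M' where M': "0 \<le> M'"
    "\<And>z w. z \<notin> K \<Longrightarrow> infdist z K < \<delta> \<Longrightarrow> w \<notin> K \<Longrightarrow> infdist w K < \<delta> \<Longrightarrow> ?k' z w \<le> M'"
    using kobayashi_bounded_near_removed_compact[OF GK K(1,2) lines \<delta> nbhd] by metis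
  obtain a where a: "a \<in> K"
    using K(2) by blast
  obtain M where M: "\<And>b. b \<in> K \<Longrightarrow> ?k b a \<le> M"
    using kobayashi_bounded_on_compact[OF G(1) K(1,3)] a by metis
  obtain \<Lambda> where \<Lambda>: "0 < \<Lambda>"
    "\<And>\<phi> \<zeta>. holomorphic_disc G \<phi> \<Longrightarrow> cmod \<zeta> < 1 \<Longrightarrow> dist (\<phi> 0) (\<phi> \<zeta>) \<le> \<Lambda> * cmod \<zeta>"
    using bounded_discs_Lipschitz_at_centre[OF G(2)] by metis
  define r0 where "r0 = min (1 / 2) (\<delta> / \<Lambda>)"
  have r0: "0 < r0" "r0 < 1"
    using \<delta> \<Lambda>(1) by (auto simp: r0_def)
  have "r0 \<le> \<delta> / \<Lambda>"
    by (simp add: r0_def)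
  then have r0\<delta>: "\<Lambda> * r0 \<le> \<delta>"
    using \<Lambda>(1) by (simp add: pos_le_divide_eq mult.commute)
  define E where "E = 8 * exp (2 * M) / (3 * r0)"
  have E: "0 \<le> E"
    using r0 by (simp add: E_def)
  have aG: "a \<in> G"
    using a K(3) by blast
  have far_step: "y \<in> G - K" "?k' x y \<le> t + E * (t * exp (- 2 * ?k x a))"
    if "\<delta> \<le> infdist x K" "disc_step G x y t" "t \<le> r0 / 2" for x y t
  proof -
    have far: "\<Lambda> * r0 \<le> dist x b" if "b \<in> K" for b
      using infdist_le[OF that, of x] \<open>\<delta> \<le> infdist x K\<close> r0\<delta> by linarith
    note * = kobayashi_Diff_step_le[OF G(1) GK aG M \<Lambda> r0 far that(2,3)]
    show "y \<in> G - K" "?k' x y \<le> t + E * (t * exp (- 2 * ?k x a))"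
      using * by (simp_all add: E_def)
  qed
  \<comment> \<open>The factor \<open>exp 2\<close> pays for measuring the error of a step at either of its ends, whose distances to
    \<open>a\<close> differ by at most 1.\<close>
  define C where "C = 1 + M' + E * exp 2 * (2 * pi * exp 1)"
  show ?thesis
  proof (rule that[of C])
    show "0 < C"
      using M' E by (simp add: C_def add_pos_nonneg)
    fix x y assume xy: "x \<in> G - K" "y \<in> G - K"
    then obtain l where l: "l < ?k x y + 1" "disc_chain G (r0 / 2) x y l"
      using kobayashi_near_chain[OF G(1), of x y "r0 / 2" 1] r0 by auto
    then obtain N X t where X: "X 0 = x" "X N = y" "l = (\<Sum>i<N. t i)"
      and step: "\<And>i. i < N \<Longrightarrow> disc_step G (X i) (X (Suc i)) (t i)" "\<And>i. i < N \<Longrightarrow> t i \<le> r0 / 2"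
      using disc_chain_imp_sequence[OF l(2)] by blast
    have t: "0 \<le> t i" "t i \<le> 1" if "i < N" for i
      using disc_step_mem(1)[OF step(1)[OF that]] step(2)[OF that] r0 by auto
    define e where "e i = t i + E * exp 2 * (t i * exp (- 2 * ?k (X i) a))" for i
    have e: "0 \<le> e i" if "i < N" for i
      using t[OF that] E by (simp add: e_def)
    have forward: "X (Suc i) \<in> G - K \<and> ?k' (X i) (X (Suc i)) \<le> e i"
      if i: "i < N" "\<delta> \<le> infdist (X i) K" for i
    proof -
      have "E * (t i * exp (- 2 * ?k (X i) a)) \<le> E * exp 2 * (t i * exp (- 2 * ?k (X i) a))"
        using E t[OF i(1)] by (intro mult_right_mono) (auto simp: mult_le_cancel_left1)
      then show ?thesis
        using far_step[OF i(2) step(1,2)[OF i(1)]] by (simp add: e_def)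
    qed
    have backward: "X i \<in> G - K \<and> ?k' (X i) (X (Suc i)) \<le> e i"
      if i: "i < N" "\<delta> \<le> infdist (X (Suc i)) K" for i
    proof -
      note st = step(1)[OF i(1)]
      have "?k (X i) a \<le> ?k (X (Suc i)) a + t i"
        using kobayashi_triangle[OF G(1) disc_step_mem(2,3)[OF st] aG] kobayashi_le_step[OF G(1) st]
        by linarith
      then have "- 2 * ?k (X (Suc i)) a \<le> 2 + - 2 * ?k (X i) a"
        using t[OF i(1)] by linarith
      then have "exp (- 2 * ?k (X (Suc i)) a) \<le> exp 2 * exp (- 2 * ?k (X i) a)"
        unfolding exp_add[symmetric] by simp
      then have "E * t i * exp (- 2 * ?k (X (Suc i)) a) \<le> E * t i * (exp 2 * exp (- 2 * ?k (X i) a))"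
        using E t[OF i(1)] by (intro mult_left_mono) auto
      then show ?thesis
        using far_step[OF i(2) disc_step_sym[OF st] step(2)[OF i(1)]]
          kobayashi_commute[OF GK, of "X i" "X (Suc i)"] by (simp add: e_def mult.assoc mult.left_commute)
    qed
    have from_start: "X n \<in> G - K \<and> ?k' x (X n) \<le> (\<Sum>i<n. e i)"
      if "n \<le> N" "\<And>i. i < n \<Longrightarrow> \<delta> \<le> infdist (X i) K" for n
      using that
    proof (induction n)
      case 0
      then show ?case
        using X(1) xy(1) kobayashi_refl[OF GK] by simp
    next
      case (Suc n)
      then have IH: "X n \<in> G - K" "?k' x (X n) \<le> (\<Sum>i<n. e i)"
        and st: "X (Suc n) \<in> G - K" "?k' (X n) (X (Suc n)) \<le> e n"
        using forward[of n] by auto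
      then show ?case
        using kobayashi_triangle[OF GK xy(1) IH(1) st(1)] by simp
    qed
    have to_end: "X n \<in> G - K \<and> ?k' (X n) y \<le> (\<Sum>i=n..<N. e i)"
      if "n \<le> N" "\<And>i. n < i \<Longrightarrow> i \<le> N \<Longrightarrow> \<delta> \<le> infdist (X i) K" for n
      using that
    proof (induction n rule: inc_induct)
      case base
      then show ?case
        using X(2) xy(2) kobayashi_refl[OF GK] by simp
    next
      case (step n)
      then have IH: "X (Suc n) \<in> G - K" "?k' (X (Suc n)) y \<le> (\<Sum>i=Suc n..<N. e i)"
        and st: "X n \<in> G - K" "?k' (X n) (X (Suc n)) \<le> e n"
        using backward[of n] by auto
      have "(\<Sum>i=n..<N. e i) = e n + (\<Sum>i=Suc n..<N. e i)"
        using step.hyps by (simp add: sum.atLeast_Suc_lessThan)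
      then show ?case
        using kobayashi_triangle[OF GK st(1) IH(1) xy(2)] IH st by simp
    qed
    have main: "?k' x y \<le> (\<Sum>i<N. e i) + M'"
    proof (cases "\<forall>i\<le>N. \<delta> \<le> infdist (X i) K")
      case True
      then show ?thesis
        using from_start[of N] X(2) M'(1) by simp
    next
      case False
      define near where "near = {i. i \<le> N \<and> infdist (X i) K < \<delta>}"
      have near: "finite near" "near \<noteq> {}"
        using False unfolding near_def by (simp, blast intro: leI)
      define p q where "p = Min near" and "q = Max near"
      have pq: "p \<in> near" "q \<in> near" "p \<le> q"
        using near Min_in Max_in Min_le by (auto simp: p_def q_def)
      have extreme: "p \<le> i" "i \<le> q" if "i \<in> near" for i
        using near(1) that by (auto simp: p_def q_def)
      have "\<delta> \<le> infdist (X i) K" if "i < p" for i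
        by (rule ccontr) (use that pq(1) extreme(1)[of i] in \<open>simp add: near_def\<close>)
      then have 1: "X p \<in> G - K" "?k' x (X p) \<le> (\<Sum>i<p. e i)"
        using from_start[of p] pq(1) by (auto simp: near_def)
      have "\<delta> \<le> infdist (X i) K" if "q < i" "i \<le> N" for i
        by (rule ccontr) (use that extreme(2)[of i] in \<open>simp add: near_def\<close>)
      then have 2: "X q \<in> G - K" "?k' (X q) y \<le> (\<Sum>i=q..<N. e i)"
        using to_end[of q] pq(2) by (auto simp: near_def)
      have 3: "?k' (X p) (X q) \<le> M'"
        using M'(2) 1(1) 2(1) pq(1,2) by (simp add: near_def)
      have "q \<le> N"
        using pq(2) by (simp add: near_def)
      have "(\<Sum>i<p. e i) \<le> (\<Sum>i<q. e i)"
        using pq(3) \<open>q \<le> N\<close> e by (intro sum_mono2) auto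
      moreover have "(\<Sum>i<q. e i) + (\<Sum>i=q..<N. e i) = (\<Sum>i<N. e i)"
        using \<open>q \<le> N\<close> by (simp add: lessThan_atLeast0 sum.atLeastLessThan_concat)
      ultimately show ?thesis
        using kobayashi_triangle[OF GK xy(1) 1(1) xy(2)] kobayashi_triangle[OF GK 1(1) 2(1) xy(2)]
          1(2) 2(2) 3 by linarith
    qed
    have "(\<Sum>i<N. t i * exp (- 2 * ?k (X i) a)) \<le> 2 * pi * exp 1"
    proof (cases "N = 0")
      case False
      then show ?thesis
        using step t(2) X l(1) by (intro near_geodesic_exp_decay[OF G(1) aG]) auto
    qed simp
    then have "(\<Sum>i<N. e i) \<le> l + E * exp 2 * (2 * pi * exp 1)"
      unfolding e_def sum.distrib sum_distrib_left[symmetric] X(3)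
      using E by (intro add_left_mono mult_left_mono) auto
    then show "?k' x y \<le> ?k x y + C"
      using main l(1) by (simp add: C_def)
  qed
qed

text \<open>
  A Gromov product involves three distances and so moves by at most \<open>3 * C\<close>; the defect is a
  difference of two such quantities.
\<close>

lemma gromov_hyperbolic_subset_bounded_perturbation:
  assumes hyp: "gromov_hyperbolic Y d" and XY: "X \<subseteq> Y" and metric: "Metric_space X d'"
    and close: "\<And>x y. x \<in> X \<Longrightarrow> y \<in> X \<Longrightarrow> \<bar>d' x y - d x y\<bar> \<le> C"
  shows "gromov_hyperbolic X d'"
proof -
  obtain B where B: "\<And>p q x w. p \<in> Y \<Longrightarrow> q \<in> Y \<Longrightarrow> x \<in> Y \<Longrightarrow> w \<in> Y \<Longrightarrow> gromov_defect d p q x w \<le> B"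
    using hyp unfolding gromov_hyperbolic_def bdd_above_def by blast
  have product: "\<bar>gromov_product d' x y z - gromov_product d x y z\<bar> \<le> 3 * C"
    if "x \<in> X" "y \<in> X" "z \<in> X" for x y z
    using close[of x z] close[of z y] close[of x y] that by (simp add: gromov_product_def)
  have "gromov_defect d' p q x w \<le> B + 6 * C" if X: "p \<in> X" "q \<in> X" "x \<in> X" "w \<in> X" for p q x w
  proof -
    have "p \<in> Y" "q \<in> Y" "x \<in> Y" "w \<in> Y"
      using X XY by auto
    from B[OF this] show ?thesis
      using product[OF X(1,3,4)] product[OF X(3,2,4)] product[OF X(1,2,4)]
      by (auto simp: gromov_defect_def min_def split: if_splits)
  qed
  then show ?thesis
    using metric unfolding gromov_hyperbolic_def bdd_above_def by blast
qed

theorem proposition6: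
  fixes G K :: "(complex^'n) set"
  assumes "CARD('n) \<ge> 2"
    and "domain G" and "bounded G"
    and "compact K" and "K \<subseteq> G"
    and "\<And>z. z \<notin> K \<Longrightarrow> \<exists>L. complex_line L \<and> z \<in> L \<and> L \<inter> K = {}"
  shows "domain (G - K) \<and>
         quasi_isometrically_equivalent (G - K) (kobayashi (G - K)) (kobayashi G) \<and>
         (gromov_k_hyperbolic G \<longrightarrow> gromov_k_hyperbolic (G - K))"
proof -
  have "connected (- K)"
    using complement_connected_if_lines_escape[OF compact_imp_bounded] assms(4,6) by blast
  then have GK: "domain (G - K)"
    using domain_Diff_compact[OF assms(2,4,5)] by blast
  have metric: "Metric_space (G - K) (kobayashi (G - K))" "Metric_space (G - K) (kobayashi G)"
    using kobayashi_bounded_domain_Metric_space[OF GK _ subset_refl]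
      kobayashi_bounded_domain_Metric_space[OF assms(2,3)] assms(3) bounded_subset[of G "G - K"]
    by auto
  obtain C where C: "0 < C"
    "\<And>x y. x \<in> G - K \<Longrightarrow> y \<in> G - K \<Longrightarrow> kobayashi (G - K) x y \<le> kobayashi G x y + C"
  proof (cases "K = {}")
    case True
    then show ?thesis
      using that[of 1] by simp
  next
    case False
    then show ?thesis
      using kobayashi_Diff_le_add_const[OF assms(2,3) GK assms(4) False assms(5,6)] that by metis
  qed
  have lower: "kobayashi G x y \<le> kobayashi (G - K) x y" if "x \<in> G - K" "y \<in> G - K" for x y
    using kobayashi_antimono[OF GK assms(2) _ that] by simp
  have "quasi_isometrically_equivalent (G - K) (kobayashi (G - K)) (kobayashi G)"
    unfolding quasi_isometrically_equivalent_def
  proof (intro conjI metric, rule exI[of _ 1], intro conjI, simp, rule exI[of _ C], intro conjI ballI)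
    fix x y assume xy: "x \<in> G - K" "y \<in> G - K"
    show "inverse 1 * kobayashi (G - K) x y - C \<le> kobayashi G x y"
      using C(2)[OF xy] by simp
    show "kobayashi G x y \<le> 1 * kobayashi (G - K) x y + C"
      using lower[OF xy] C(1) by simp
  qed (rule C(1))
  moreover have "gromov_k_hyperbolic (G - K)" if "gromov_k_hyperbolic G"
    unfolding gromov_k_hyperbolic_def
  proof (rule gromov_hyperbolic_subset_bounded_perturbation[OF _ Diff_subset metric(1)])
    show "gromov_hyperbolic G (kobayashi G)"
      using that by (simp add: gromov_k_hyperbolic_def)
    show "\<bar>kobayashi (G - K) x y - kobayashi G x y\<bar> \<le> C" if "x \<in> G - K" "y \<in> G - K" for x y
      using lower[OF that] C(2)[OF that] C(1) by simp
  qed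
  ultimately show ?thesis
    using GK by blast
qed

end
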